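(* Let $\mathcal{A}$ be a unital $*$-algebra with two states $\varphi,\psi$ ($\psi$ tracial), and let $\mathbb{X}_1,\mathbb{X}_2,\dots\in\mathcal{A}$ be such that: (1) the sequence satisfies Kargin's Condition A with respect to $(\varphi|\psi)$; (2) for every $k\ge1$, $\sup_{j_1,\dots,j_k\ge1}|\varphi(\mathbb{X}_{j_1}\cdots\mathbb{X}_{j_k})|\le C_k<\infty$; (3) with $s_j^2:=\psi(\mathbb{X}_j^2)$ and $S_j^2:=\varphi(\mathbb{X}_j^2)$, we have $(s_1^2+\dots+s_n^2)/n\to s^2$ and $(S_1^2+\dots+S_n^2)/n\to S^2$; (4) $0<s,S<\infty$; (5) the $\psi$-moments of $\frac{1}{\sqrt{s_1^2+\dots+s_n^2}}\sum_{j=1}^n\mathbb{X}_j$ converge to the corresponding moments of a compactly supported probability measure $\nu$. Then the $\varphi$-moments of $\frac{1}{\sqrt{S_1^2+\dots+S_n^2}}\sum_{j=1}^n\mathbb{X}_j$ converge to the moments of the unique compactly supported probability measure $\mu$ whose Cauchy transform is $$G(z)=\int\frac{\mu(dx)}{z-x}=\frac{1}{z-g(z)},\qquad g(z)=\int\frac{S}{Sz-sx}\,\nu(dx).$$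
   Context: $\mathcal{A}$ is a unital $*$-algebra with two states (positive normalized linear functionals) $\varphi,\psi$, $\psi$ tracial. A sequence $\mathbb{X}_1,\mathbb{X}_2,\dots$ satisfies Kargin's Condition A with respect to $(\varphi|\psi)$ if: (i) for every $k\notin\{j_1,\dots,j_r\}$ (any $r\ge0$), $\varphi(\mathbb{X}_k\mathbb{X}_{j_1}\cdots\mathbb{X}_{j_r})=\varphi(\mathbb{X}_{j_1}\mathbb{X}_k\mathbb{X}_{j_2}\cdots\mathbb{X}_{j_r})=\dots=\varphi(\mathbb{X}_{j_1}\cdots\mathbb{X}_{j_r}\mathbb{X}_k)=0$ and $\psi(\mathbb{X}_k\mathbb{X}_{j_1}\cdots\mathbb{X}_{j_r})=0$ (in particular $\varphi(\mathbb{X}_j)=\psi(\mathbb{X}_j)=0$); (ii) for every $k\notin\{j_1,\dots,j_r\}$ and $0\le p\le r$, $$\varphi(\mathbb{X}_k\mathbb{X}_{j_1}\cdots\mathbb{X}_{j_p}\mathbb{X}_k\mathbb{X}_{j_{p+1}}\cdots\mathbb{X}_{j_r})=\varphi(\mathbb{X}_k^2)\,\psi(\mathbb{X}_{j_1}\cdots\mathbb{X}_{j_p})\,\varphi(\mathbb{X}_{j_{p+1}}\cdots\mathbb{X}_{j_r}),$$ with empty products equal to $1$. *)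

theory Defs
  imports "HOL-Analysis.Analysis" "HOL-Probability.Probability"
begin

definition star_algebra :: "(complex \<Rightarrow> 'a::ring_1 \<Rightarrow> 'a) \<Rightarrow> ('a \<Rightarrow> 'a) \<Rightarrow> bool" where
  "star_algebra sc st \<longleftrightarrow>
     (\<forall>c a b. sc c (a + b) = sc c a + sc c b) \<and>
     (\<forall>c d a. sc (c + d) a = sc c a + sc d a) \<and>
     (\<forall>c d a. sc (c * d) a = sc c (sc d a)) \<and>
     (\<forall>a. sc 1 a = a) \<and>
     (\<forall>c a b. sc c (a * b) = sc c a * b) \<and>
     (\<forall>c a b. sc c (a * b) = a * sc c b) \<and>
     (\<forall>a. st (st a) = a) \<and>
     (\<forall>a b. st (a + b) = st a + st b) \<and>
     (\<forall>c a. st (sc c a) = sc (cnj c) (st a)) \<and>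
     (\<forall>a b. st (a * b) = st b * st a)"

definition is_state :: "(complex \<Rightarrow> 'a::ring_1 \<Rightarrow> 'a) \<Rightarrow> ('a \<Rightarrow> 'a) \<Rightarrow> ('a \<Rightarrow> complex) \<Rightarrow> bool" where
  "is_state sc st f \<longleftrightarrow>
     (\<forall>a b. f (a + b) = f a + f b) \<and>
     (\<forall>c a. f (sc c a) = c * f a) \<and>
     f 1 = 1 \<and>
     (\<forall>a. Im (f (st a * a)) = 0 \<and> Re (f (st a * a)) \<ge> 0)"

definition tracial :: "('a::ring_1 \<Rightarrow> complex) \<Rightarrow> bool" where
  "tracial f \<longleftrightarrow> (\<forall>a b. f (a * b) = f (b * a))"

definition wprod :: "(nat \<Rightarrow> 'a::ring_1) \<Rightarrow> nat list \<Rightarrow> 'a" where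
  "wprod X js = prod_list (map X js)"

definition kargin_condA :: "('a::ring_1 \<Rightarrow> complex) \<Rightarrow> ('a \<Rightarrow> complex) \<Rightarrow> (nat \<Rightarrow> 'a) \<Rightarrow> bool" where
  "kargin_condA \<phi> \<psi> X \<longleftrightarrow>
     (\<forall>k js. k \<notin> set js \<longrightarrow>
        (\<forall>p\<le>length js. \<phi> (wprod X (take p js) * X k * wprod X (drop p js)) = 0) \<and>
        \<psi> (X k * wprod X js) = 0) \<and>
     (\<forall>k js p. k \<notin> set js \<longrightarrow> p \<le> length js \<longrightarrow>
        \<phi> (X k * wprod X (take p js) * X k * wprod X (drop p js)) =
        \<phi> (X k * X k) * \<psi> (wprod X (take p js)) * \<phi> (wprod X (drop p js)))"

definition compact_support :: "real measure \<Rightarrow> bool" where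
  "compact_support M \<longleftrightarrow> (\<exists>K. compact K \<and> K \<in> sets M \<and> emeasure M (space M - K) = 0)"

definition cpm :: "real measure \<Rightarrow> bool" where
  "cpm M \<longleftrightarrow> prob_space M \<and> sets M = sets borel \<and> compact_support M"

definition cauchy_transform :: "real measure \<Rightarrow> complex \<Rightarrow> complex" where
  "cauchy_transform M z = (\<integral>x. 1 / (z - complex_of_real x) \<partial>M)"

definition moment :: "real measure \<Rightarrow> nat \<Rightarrow> real" where
  "moment M m = (\<integral>x. x ^ m \<partial>M)"

end

theory Submission
  imports Defs "HOL-Computational_Algebra.Fundamental_Theorem_Algebra"
begin

text \<open>
  Expand \<open>\<phi>((X\<^sub>1 + \<dots> + X\<^sub>n)\<^sup>m)\<close> over words and compare each word with first letter \<open>k\<close>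
  with the sum of \<open>\<phi>(X\<^sub>k\<^sup>2) \<psi>(u) \<phi>(v)\<close> over its decompositions \<open>k u k v\<close>. By condition A
  the two agree unless every letter of the word occurs at least twice and \<open>k\<close> at least three times;
  there are only \<open>O(n\<^bsup>(m-1)/2\<^esup>)\<close> such words. Hence the limits \<open>\<mu>\<^sub>m\<close> of the normalised
  \<open>\<phi>\<close>-moments satisfy \<open>\<mu>\<^sub>m\<^sub>+\<^sub>2 = \<Sum>p\<le>m. \<rho>\<^sub>p \<mu>\<^sub>m\<^sub>-\<^sub>p\<close> with \<open>\<rho>\<close> the image of \<open>\<nu>\<close> under
  \<open>x \<mapsto> (s/S) x\<close>, which is the moment form of \<open>G = 1 / (z - g)\<close>.

  For finitely supported \<open>\<rho>\<close> the function \<open>1 / (z - g)\<close> is a rational function with real simple poles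
  and positive residues, so \<open>\<mu>\<close> exists by partial fractions. In general discretise \<open>\<rho>\<close>; the
  discrete \<open>\<mu>\<close> have uniformly bounded supports, and Helly's theorem provides a limit.
\<close>

subsection \<open>Reciprocal Cauchy transforms of finitely supported measures\<close>

text \<open>For infinite \<open>A\<close> the product is 1 and \<open>card A\<close> is 0, so degree
  and leading coefficient are described correctly for every \<open>A\<close>.\<close>

definition root_poly :: "real set \<Rightarrow> complex poly" where
  "root_poly A = (\<Prod>a\<in>A. [:- complex_of_real a, 1:])"

lemma poly_root_poly: "poly (root_poly A) z = (\<Prod>a\<in>A. z - complex_of_real a)"
  by (simp add: root_poly_def poly_prod)

lemma degree_root_poly: "degree (root_poly A) = card A"
  unfolding root_poly_def by (subst degree_prod_sum_eq) auto

lemma coeff_root_poly: "poly.coeff (root_poly A) (card A) = 1"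
proof -
  have "lead_coeff (root_poly A) = 1"
    unfolding root_poly_def by (simp add: lead_coeff_prod)
  thus ?thesis by (simp add: degree_root_poly)
qed

lemma poly_root_poly_remove:
  assumes "finite A" "a \<in> A"
  shows "poly (root_poly A) z = (z - complex_of_real a) * poly (root_poly (A - {a})) z"
  unfolding poly_root_poly using assms by (rule prod.remove)

text \<open>By the product rule, only the term that differentiates the factor \<open>z - a\<close>
  survives at \<open>a\<close>.\<close>

lemma pderiv_root_poly:
  assumes "finite A" "a \<in> A"
  shows "poly (pderiv (root_poly A)) (complex_of_real a) = poly (root_poly (A - {a})) (complex_of_real a)"
proof -
  have "root_poly A = [:- complex_of_real a, 1:] * root_poly (A - {a})"
    unfolding root_poly_def using assms by (rule prod.remove)
  thus ?thesis by (simp only: pderiv_mult poly_add poly_mult) (simp add: pderiv_pCons)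
qed

text \<open>The polynomial is the numerator of a sum of simple fractions over the common denominator
  \<open>root_poly A\<close>. This serves twice: for \<open>g\<close>, with poles \<open>V\<close>,
  and for the partial fractions of \<open>P / R\<close>, with poles
  \<open>\<Lambda>\<close>.\<close>

lemma poly_sum_root_poly_remove:
  assumes "finite A" "z \<notin> complex_of_real ` A"
  shows "poly (\<Sum>a\<in>A. smult (complex_of_real (w a)) (root_poly (A - {a}))) z =
    poly (root_poly A) z * (\<Sum>a\<in>A. complex_of_real (w a) / (z - complex_of_real a))"
proof -
  have "complex_of_real (w a) * poly (root_poly (A - {a})) z =
      poly (root_poly A) z * (complex_of_real (w a) / (z - complex_of_real a))" if "a \<in> A" for a
    using poly_root_poly_remove[OF assms(1) that, of z] assms(2) that by (auto simp: image_iff)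
  thus ?thesis by (simp add: poly_sum sum_distrib_left)
qed

text \<open>Every summand with \<open>a \<noteq> b\<close> still contains the factor
  \<open>z - b\<close>.\<close>

lemma poly_sum_root_poly_remove_root:
  assumes "finite A" "b \<in> A"
  shows "poly (\<Sum>a\<in>A. smult (complex_of_real (w a)) (root_poly (A - {a}))) (complex_of_real b) =
    complex_of_real (w b) * poly (root_poly (A - {b})) (complex_of_real b)"
proof -
  have "complex_of_real (w a) * poly (root_poly (A - {a})) (complex_of_real b) =
      (if a = b then complex_of_real (w b) * poly (root_poly (A - {b})) (complex_of_real b) else 0)"
    if "a \<in> A" for a
    using assms by (auto simp: poly_root_poly)
  hence "(\<Sum>a\<in>A. complex_of_real (w a) * poly (root_poly (A - {a})) (complex_of_real b)) =
      (\<Sum>a\<in>A. if a = b then complex_of_real (w b) * poly (root_poly (A - {b})) (complex_of_real b) else 0)"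
    by (rule sum.cong[OF refl])
  also have "\<dots> = complex_of_real (w b) * poly (root_poly (A - {b})) (complex_of_real b)"
    using assms by simp
  finally show ?thesis by (simp only: poly_sum poly_smult)
qed

lemma poly_root_poly_nonzero:
  assumes "z \<notin> complex_of_real ` A"
  shows "poly (root_poly A) z \<noteq> 0"
proof (cases "finite A")
  case True
  thus ?thesis using assms by (auto simp: poly_root_poly)
qed (simp add: root_poly_def)

lemma degree_sum_root_poly_remove:
  assumes "finite A" "A \<noteq> {}"
  shows "degree (\<Sum>a\<in>A. smult (c a) (root_poly (A - {a}))) < card A"
proof -
  have "degree (\<Sum>a\<in>A. smult (c a) (root_poly (A - {a}))) \<le> card A - 1"
    using assms by (intro degree_sum_le) (auto intro: order_trans[OF degree_smult_le] simp: degree_root_poly)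
  moreover have "card A > 0" using assms by (simp add: card_gt_0_iff)
  ultimately show ?thesis by simp
qed

lemma Im_sum_inverse:
  "Im (\<Sum>v\<in>V. complex_of_real (w v) / (z - complex_of_real v)) =
     - Im z * (\<Sum>v\<in>V. w v / (cmod (z - complex_of_real v))\<^sup>2)"
  by (simp add: Im_divide cmod_power2 sum_distrib_left sum_negf mult.commute)

text \<open>A root of \<open>R = P \<cdot> (z - g)\<close>, with \<open>P\<close> the polynomial of the poles of \<open>g\<close>, is real because
  \<open>Im (z - g z)\<close> has the sign of \<open>Im z\<close>, and simple because \<open>1 - g' \<ge> 1\<close> on the real axis.
  Its residue in \<open>P / R\<close> is \<open>1 / (1 - g')\<close>.\<close>

lemma discrete_reciprocal:
  fixes V :: "real set" and w :: "real \<Rightarrow> real"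
  assumes V: "finite V" "V \<noteq> {}" and w: "\<And>v. v \<in> V \<Longrightarrow> w v > 0"
  shows "\<exists>\<Lambda> c. finite \<Lambda> \<and> (\<forall>l\<in>\<Lambda>. c l \<ge> 0) \<and> sum c \<Lambda> = 1 \<and> \<Lambda> \<inter> V = {} \<and>
    (\<forall>l\<in>\<Lambda>. l = (\<Sum>v\<in>V. w v / (l - v))) \<and>
    (\<forall>v\<in>V. (\<Sum>l\<in>\<Lambda>. c l / (v - l)) = 0) \<and>
    (\<forall>z. Im z \<noteq> 0 \<longrightarrow> (z - (\<Sum>v\<in>V. complex_of_real (w v) / (z - complex_of_real v))) *
       (\<Sum>l\<in>\<Lambda>. complex_of_real (c l) / (z - complex_of_real l)) = 1)"
proof -
  \<comment> \<open>\<open>Q / P\<close> is \<open>g\<close> over its common denominator, and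
    \<open>pCons 0 P\<close> is \<open>z * P\<close>. So \<open>R\<close> is the numerator of
    \<open>z - g\<close>, and \<open>1 / (z - g)\<close> is \<open>P / R\<close>.\<close>
  define P where "P = root_poly V"
  define Q where "Q = (\<Sum>v\<in>V. smult (complex_of_real (w v)) (root_poly (V - {v})))"
  define R where "R = pCons 0 P - Q"
  define g where "g z = (\<Sum>v\<in>V. complex_of_real (w v) / (z - complex_of_real v))" for z
  define N where "N = card V"
  have P0: "P \<noteq> 0" unfolding P_def root_poly_def using V by simp
  have degP: "degree P = N" by (simp add: P_def N_def degree_root_poly)
  have degQ: "degree Q < N" unfolding Q_def N_def using V by (rule degree_sum_root_poly_remove)
  have degR: "degree R = Suc N"
    unfolding R_def diff_conv_add_uminus using degP degQ P0
    by (subst degree_add_eq_left) (auto simp: degree_pCons_eq)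
  have leadR: "lead_coeff R = 1"
    using coeff_root_poly[of V] degQ by (simp add: degR) (simp add: R_def P_def N_def coeff_eq_0)
  have R0: "R \<noteq> 0" using degR by auto
  have polyR: "poly R z = poly P z * (z - g z)" if "z \<notin> complex_of_real ` V" for z
    using poly_sum_root_poly_remove[OF V(1) that, of w]
    by (simp add: R_def P_def Q_def g_def algebra_simps)
  \<comment> \<open>At a pole \<open>v\<close> of \<open>g\<close>, \<open>P\<close> vanishes but
    \<open>Q\<close> does not: only the summand of \<open>v\<close> survives, and its weight is
    positive.\<close>
  have polyRV: "poly R (complex_of_real v) \<noteq> 0" if "v \<in> V" for v
  proof -
    have "poly P (complex_of_real v) = 0"
      using poly_root_poly_remove[OF V(1) that, of "complex_of_real v"] by (simp add: P_def)
    moreover have "poly (root_poly (V - {v})) (complex_of_real v) \<noteq> 0"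
      by (rule poly_root_poly_nonzero) auto
    hence "poly Q (complex_of_real v) \<noteq> 0"
      unfolding Q_def poly_sum_root_poly_remove_root[OF V(1) that] using w[OF that] by simp
    ultimately show ?thesis by (simp add: R_def)
  qed
  have Img: "Im (z - g z) \<noteq> 0" if "Im z \<noteq> 0" for z
  proof -
    define s where "s = (\<Sum>v\<in>V. w v / (cmod (z - complex_of_real v))\<^sup>2)"
    have "s \<ge> 0" unfolding s_def by (intro sum_nonneg divide_nonneg_nonneg) (auto intro: less_imp_le w)
    moreover have "Im (z - g z) = Im z * (1 + s)"
      unfolding s_def g_def minus_complex.sel Im_sum_inverse by (simp add: algebra_simps)
    ultimately show ?thesis using that by simp
  qed
  have zg: "z - g z \<noteq> 0" if "Im z \<noteq> 0" for z
  proof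
    assume "z - g z = 0"
    hence "Im (z - g z) = 0" by simp
    thus False using Img[OF that] by simp
  qed
  have nV: "z \<notin> complex_of_real ` V" if "Im z \<noteq> 0" for z using that by auto
  \<comment> \<open>Only the real roots are collected; \<open>roots\<close> then shows that there
    are no others.\<close>
  define \<Lambda> where "\<Lambda> = {l. poly R (complex_of_real l) = 0}"
  have roots: "{z. poly R z = 0} = complex_of_real ` \<Lambda>"
  proof -
    have "z \<in> complex_of_real ` \<Lambda>" if "poly R z = 0" for z
    proof -
      have "Im z = 0"
        using polyR[OF nV, of z] zg[of z] poly_root_poly_nonzero[OF nV, of z] that
        unfolding P_def by auto
      then obtain l where "z = complex_of_real l" by (metis complex_is_Real_iff Reals_cases)
      thus ?thesis using that by (auto simp: \<Lambda>_def)
    qed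
    thus ?thesis by (auto simp: \<Lambda>_def)
  qed
  have disj: "\<Lambda> \<inter> V = {}" using polyRV by (auto simp: \<Lambda>_def)
  have fin: "finite \<Lambda>"
    using poly_roots_finite[OF R0] unfolding roots by (rule finite_imageD) (auto simp: inj_on_def)
  have fixpt: "complex_of_real l = g (complex_of_real l)" if "l \<in> \<Lambda>" for l
  proof -
    have nin: "complex_of_real l \<notin> complex_of_real ` V" using that disj by auto
    have "poly P (complex_of_real l) * (complex_of_real l - g (complex_of_real l)) = 0"
      using polyR[OF nin] that by (simp add: \<Lambda>_def)
    thus ?thesis using poly_root_poly_nonzero[OF nin] unfolding P_def by simp
  qed
  define c where "c l = 1 / (1 + (\<Sum>v\<in>V. w v / (l - v)\<^sup>2))" for l
  have c1: "1 + (\<Sum>v\<in>V. w v / (l - v)\<^sup>2) \<ge> 1" for l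
    by (simp add: sum_nonneg less_imp_le w)
  have cpos: "c l > 0" for l using c1[of l] by (auto simp: c_def)
  \<comment> \<open>Differentiate \<open>P * (z - g)\<close> at \<open>l\<close>: since
    \<open>g\<close> fixes \<open>l\<close>, the term with the derivative of \<open>P\<close> drops
    out, leaving \<open>P\<close> times \<open>1 - g'\<close>, which is
    \<open>P / c l\<close>.\<close>
  have derivR: "poly P (complex_of_real l) =
      complex_of_real (c l) * poly (pderiv R) (complex_of_real l)" if l: "l \<in> \<Lambda>" for l
  proof -
    let ?l = "complex_of_real l"
    have nin: "?l \<notin> complex_of_real ` V" using l disj by auto
    define d where "d = (1 + (\<Sum>v\<in>V. complex_of_real (w v) / (?l - complex_of_real v)\<^sup>2))"
    have dc: "d = complex_of_real (1 / c l)" by (simp add: d_def c_def)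
    have "((\<lambda>z. z - g z) has_field_derivative (1 - (\<Sum>v\<in>V. - complex_of_real (w v) / (?l - complex_of_real v)\<^sup>2))) (at ?l)"
      unfolding g_def using nin
      by (auto intro!: derivative_eq_intros sum.cong simp: power2_eq_square image_iff)
    hence "((\<lambda>z. z - g z) has_field_derivative d) (at ?l)"
      by (simp add: d_def sum_negf)
    hence "((\<lambda>z. poly P z * (z - g z)) has_field_derivative (poly P ?l * d)) (at ?l)"
      using DERIV_mult[OF poly_DERIV[of P], of "\<lambda>z. z - g z" d ?l] fixpt[OF l]
      by (simp add: mult.commute)
    hence "(poly R has_field_derivative (poly P ?l * d)) (at ?l)"
    proof (rule has_field_derivative_transform_within_open)
      show "open (- complex_of_real ` V)"
        using V(1) by (intro open_Compl finite_imp_closed) auto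
    qed (use nin polyR in auto)
    hence "poly (pderiv R) ?l = poly P ?l * d"
      using poly_DERIV DERIV_unique by blast
    thus ?thesis using cpos[of l] dc by simp
  qed
  have "rsquarefree R"
    unfolding rsquarefree_roots
  proof (intro allI notI)
    fix z assume z: "poly R z = 0 \<and> poly (pderiv R) z = 0"
    then obtain l where l: "l \<in> \<Lambda>" "z = complex_of_real l" using roots by auto
    have "poly P z = 0" using derivR[OF l(1)] z l(2) by simp
    moreover have "poly P z \<noteq> 0" unfolding P_def l(2)
      by (rule poly_root_poly_nonzero) (use l disj in auto)
    ultimately show False by simp
  qed
  hence "(\<Prod>z|poly R z = 0. [:-z, 1:]) = R"
    using complex_poly_decompose_rsquarefree[of R] leadR by simp
  hence Req: "R = root_poly \<Lambda>"
    unfolding roots root_poly_def by (subst (asm) prod.reindex) (auto simp: inj_on_def)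
  have card: "card \<Lambda> = Suc N" using degR degree_root_poly[of \<Lambda>] Req by simp
  have \<Lambda>0: "\<Lambda> \<noteq> {}" using card by auto
  \<comment> \<open>Interpolation: both sides have degree below \<open>Suc N\<close> and agree at
    the \<open>Suc N\<close> roots of \<open>R\<close>, by \<open>derivR\<close>.\<close>
  have Peq: "P = (\<Sum>l\<in>\<Lambda>. smult (complex_of_real (c l)) (root_poly (\<Lambda> - {l})))"
  proof (rule poly_eqI_degree[where A = "complex_of_real ` \<Lambda>"])
    have cardim: "card (complex_of_real ` \<Lambda>) = Suc N"
      using card by (subst card_image) (auto simp: inj_on_def)
    show "degree P < card (complex_of_real ` \<Lambda>)" using degP cardim by simp
    show "degree (\<Sum>l\<in>\<Lambda>. smult (complex_of_real (c l)) (root_poly (\<Lambda> - {l})))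
        < card (complex_of_real ` \<Lambda>)"
      using degree_sum_root_poly_remove[OF fin \<Lambda>0, of "\<lambda>l. complex_of_real (c l)"] card cardim by simp
    show "poly P z = poly (\<Sum>l\<in>\<Lambda>. smult (complex_of_real (c l)) (root_poly (\<Lambda> - {l}))) z"
      if "z \<in> complex_of_real ` \<Lambda>" for z
    proof -
      from that obtain l where l: "l \<in> \<Lambda>" "z = complex_of_real l" by (rule imageE)
      show ?thesis
        unfolding l(2) poly_sum_root_poly_remove_root[OF fin l(1)] derivR[OF l(1)]
        using pderiv_root_poly[OF fin l(1)] by (simp add: Req)
    qed
  qed
  have PR: "poly P z = poly R z * (\<Sum>l\<in>\<Lambda>. complex_of_real (c l) / (z - complex_of_real l))"
    if "z \<notin> complex_of_real ` \<Lambda>" for z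
    unfolding Peq Req by (rule poly_sum_root_poly_remove[OF fin that])
  show ?thesis
  proof (intro exI[of _ \<Lambda>] exI[of _ c] conjI ballI allI impI)
    \<comment> \<open>Compare the coefficients of degree \<open>N\<close> in the partial fraction
      identity: \<open>P\<close> is monic, and so is each
      \<open>root_poly (\<Lambda> - {l})\<close>.\<close>
    have "poly.coeff P N = (\<Sum>l\<in>\<Lambda>. complex_of_real (c l) * poly.coeff (root_poly (\<Lambda> - {l})) N)"
      by (subst Peq) (simp add: coeff_sum)
    also have "\<dots> = (\<Sum>l\<in>\<Lambda>. complex_of_real (c l))"
    proof (rule sum.cong)
      fix l assume "l \<in> \<Lambda>"
      hence "card (\<Lambda> - {l}) = N" using card fin by simp
      thus "complex_of_real (c l) * poly.coeff (root_poly (\<Lambda> - {l})) N = complex_of_real (c l)"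
        using coeff_root_poly[of "\<Lambda> - {l}"] by simp
    qed simp
    also have "poly.coeff P N = 1" by (simp add: P_def N_def coeff_root_poly)
    finally have "complex_of_real (sum c \<Lambda>) = complex_of_real 1" by simp
    thus "sum c \<Lambda> = 1" by (simp only: of_real_eq_iff)
    show "l = (\<Sum>v\<in>V. w v / (l - v))" if "l \<in> \<Lambda>" for l
    proof -
      have "complex_of_real l = complex_of_real (\<Sum>v\<in>V. w v / (l - v))"
        using fixpt[OF that] unfolding g_def by simp
      thus ?thesis by (simp only: of_real_eq_iff)
    qed
    \<comment> \<open>The sum is \<open>P / R\<close> at \<open>v\<close>, where \<open>P\<close>
      vanishes and \<open>R\<close> does not.\<close>
    show "(\<Sum>l\<in>\<Lambda>. c l / (v - l)) = 0" if "v \<in> V" for v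
    proof -
      have nin: "complex_of_real v \<notin> complex_of_real ` \<Lambda>" using that disj by auto
      have "poly P (complex_of_real v) = 0"
        using poly_root_poly_remove[OF V(1) that, of "complex_of_real v"] by (simp add: P_def)
      hence "(\<Sum>l\<in>\<Lambda>. complex_of_real (c l) / (complex_of_real v - complex_of_real l)) = 0"
        using PR[OF nin] polyRV[OF that] by simp
      hence "complex_of_real (\<Sum>l\<in>\<Lambda>. c l / (v - l)) = complex_of_real 0" by simp
      thus ?thesis by (simp only: of_real_eq_iff)
    qed
    show "(z - (\<Sum>v\<in>V. complex_of_real (w v) / (z - complex_of_real v))) *
       (\<Sum>l\<in>\<Lambda>. complex_of_real (c l) / (z - complex_of_real l)) = 1" if z: "Im z \<noteq> 0" for z
    proof -
      have nin: "z \<notin> complex_of_real ` \<Lambda>" using z by auto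
      have cancel: "b * c = 1" if "a = a * b * c" "a \<noteq> 0" for a b c :: complex
        using that by (simp add: mult.assoc)
      have "poly P z = poly P z * (z - g z) * (\<Sum>l\<in>\<Lambda>. complex_of_real (c l) / (z - complex_of_real l))"
        using PR[OF nin] polyR[OF nV[OF z]] by simp
      moreover have "poly P z \<noteq> 0" unfolding P_def by (rule poly_root_poly_nonzero[OF nV[OF z]])
      ultimately have "(z - g z) * (\<Sum>l\<in>\<Lambda>. complex_of_real (c l) / (z - complex_of_real l)) = 1"
        by (rule cancel)
      thus ?thesis by (simp only: g_def)
    qed
  qed (use fin disj cpos in \<open>auto intro: less_imp_le\<close>)
qed

section \<open>Moments and support of the discrete measure\<close>

lemma power_divide_diff:
  fixes l v :: real
  assumes "l \<noteq> v"
  shows "l ^ Suc m / (l - v) = (\<Sum>p\<le>m. v ^ p * l ^ (m - p)) + v ^ Suc m / (l - v)"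
proof -
  have "v ^ Suc m - l ^ Suc m = (v - l) * (\<Sum>p\<le>m. v ^ p * l ^ (m - p))"
    using power_diff_sumr2[of v "Suc m" l]
    by (simp only: lessThan_Suc_atMost diff_Suc_Suc mult.commute[of "l ^ _"])
  hence "(\<Sum>p\<le>m. v ^ p * l ^ (m - p)) = (v ^ Suc m - l ^ Suc m) / (v - l)"
    using assms by simp
  also have "\<dots> = (l ^ Suc m - v ^ Suc m) / (l - v)"
    by (metis minus_diff_eq minus_divide_divide)
  finally show ?thesis by (simp add: diff_divide_distrib)
qed

text \<open>Use the fixed point equation to replace one factor \<open>l\<close> by a sum over
  \<open>V\<close>, and exchange the sums. Dividing \<open>l ^ Suc m\<close> by \<open>l - v\<close>
  gives the convolution; the remainder is a multiple of \<open>1 / (l - v)\<close>, whose weighted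
  sum over \<open>\<Lambda>\<close> is zero.\<close>

lemma discrete_moment_recursion:
  fixes V \<Lambda> :: "real set"
  assumes disj: "\<Lambda> \<inter> V = {}"
    and fixpt: "\<And>l. l \<in> \<Lambda> \<Longrightarrow> l = (\<Sum>v\<in>V. w v / (l - v))"
    and zero: "\<And>v. v \<in> V \<Longrightarrow> (\<Sum>l\<in>\<Lambda>. c l / (v - l)) = 0"
  shows "(\<Sum>l\<in>\<Lambda>. c l * l) = 0"
    and "(\<Sum>l\<in>\<Lambda>. c l * l ^ (m + 2)) =
      (\<Sum>p\<le>m. (\<Sum>v\<in>V. w v * v ^ p) * (\<Sum>l\<in>\<Lambda>. c l * l ^ (m - p)))"
proof -
  have zero': "(\<Sum>l\<in>\<Lambda>. c l / (l - v)) = 0" if "v \<in> V" for v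
  proof -
    have "(\<Sum>l\<in>\<Lambda>. c l / (l - v)) = - (\<Sum>l\<in>\<Lambda>. c l / (v - l))"
      unfolding sum_negf[symmetric]
      by (intro sum.cong refl) (metis minus_diff_eq divide_minus_right)
    thus ?thesis using zero[OF that] by simp
  qed
  have *: "(\<Sum>l\<in>\<Lambda>. c l * (l ^ k * l)) = (\<Sum>v\<in>V. w v * (\<Sum>l\<in>\<Lambda>. c l * (l ^ k / (l - v))))" for k
  proof -
    have "(\<Sum>l\<in>\<Lambda>. c l * (l ^ k * l)) = (\<Sum>l\<in>\<Lambda>. c l * (l ^ k * (\<Sum>v\<in>V. w v / (l - v))))"
      using fixpt by (intro sum.cong refl) auto
    also have "\<dots> = (\<Sum>l\<in>\<Lambda>. \<Sum>v\<in>V. w v * (c l * (l ^ k / (l - v))))"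
      by (simp add: sum_distrib_left mult_ac)
    also have "\<dots> = (\<Sum>v\<in>V. \<Sum>l\<in>\<Lambda>. w v * (c l * (l ^ k / (l - v))))" by (rule sum.swap)
    finally show ?thesis by (simp add: sum_distrib_left)
  qed
  show "(\<Sum>l\<in>\<Lambda>. c l * l) = 0" using *[of 0] zero' by simp
  have "(\<Sum>l\<in>\<Lambda>. c l * l ^ (m + 2)) = (\<Sum>v\<in>V. w v * (\<Sum>l\<in>\<Lambda>. c l * (l ^ Suc m / (l - v))))"
    using *[of "Suc m"] by (simp add: mult_ac)
  also have "\<dots> = (\<Sum>v\<in>V. w v * (\<Sum>l\<in>\<Lambda>. c l * (\<Sum>p\<le>m. v ^ p * l ^ (m - p))))"
  proof (rule sum.cong)
    fix v assume v: "v \<in> V"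
    have "(\<Sum>l\<in>\<Lambda>. c l * (l ^ Suc m / (l - v))) =
        (\<Sum>l\<in>\<Lambda>. c l * (\<Sum>p\<le>m. v ^ p * l ^ (m - p)) + v ^ Suc m * (c l / (l - v)))"
    proof (rule sum.cong)
      fix l assume "l \<in> \<Lambda>"
      hence "l \<noteq> v" using v disj by auto
      thus "c l * (l ^ Suc m / (l - v)) =
          c l * (\<Sum>p\<le>m. v ^ p * l ^ (m - p)) + v ^ Suc m * (c l / (l - v))"
        unfolding power_divide_diff[OF \<open>l \<noteq> v\<close>] by (simp add: distrib_left)
    qed simp
    also have "\<dots> = (\<Sum>l\<in>\<Lambda>. c l * (\<Sum>p\<le>m. v ^ p * l ^ (m - p))) + v ^ Suc m * (\<Sum>l\<in>\<Lambda>. c l / (l - v))"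
      by (simp add: sum.distrib sum_distrib_left)
    finally show "w v * (\<Sum>l\<in>\<Lambda>. c l * (l ^ Suc m / (l - v))) =
        w v * (\<Sum>l\<in>\<Lambda>. c l * (\<Sum>p\<le>m. v ^ p * l ^ (m - p)))"
      using zero'[OF v] by simp
  qed simp
  also have "\<dots> = (\<Sum>v\<in>V. \<Sum>l\<in>\<Lambda>. \<Sum>p\<le>m. (w v * v ^ p) * (c l * l ^ (m - p)))"
    by (simp add: sum_distrib_left mult_ac)
  also have "\<dots> = (\<Sum>v\<in>V. \<Sum>p\<le>m. \<Sum>l\<in>\<Lambda>. (w v * v ^ p) * (c l * l ^ (m - p)))"
    by (intro sum.cong refl sum.swap)
  also have "\<dots> = (\<Sum>p\<le>m. \<Sum>v\<in>V. \<Sum>l\<in>\<Lambda>. (w v * v ^ p) * (c l * l ^ (m - p)))"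
    by (rule sum.swap)
  also have "\<dots> = (\<Sum>p\<le>m. (\<Sum>v\<in>V. w v * v ^ p) * (\<Sum>l\<in>\<Lambda>. c l * l ^ (m - p)))"
    by (simp add: sum_product)
  finally show "(\<Sum>l\<in>\<Lambda>. c l * l ^ (m + 2)) =
      (\<Sum>p\<le>m. (\<Sum>v\<in>V. w v * v ^ p) * (\<Sum>l\<in>\<Lambda>. c l * l ^ (m - p)))" .
qed

text \<open>If \<open>l\<close> were larger in modulus, every \<open>l - v\<close> would have
  modulus at least 1, and the fixed point equation would give modulus at most 1 for
  \<open>l\<close>. The bound depends on \<open>B\<close> alone, so it is uniform over all
  discretisations.\<close>

lemma discrete_reciprocal_bounded:
  fixes V :: "real set" and l :: real
  assumes w: "\<And>v. v \<in> V \<Longrightarrow> w v \<ge> 0" "sum w V = 1"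
    and V: "\<And>v. v \<in> V \<Longrightarrow> \<bar>v\<bar> \<le> B" and "l = (\<Sum>v\<in>V. w v / (l - v))"
  shows "\<bar>l\<bar> \<le> B + 1"
proof (rule ccontr)
  assume "\<not> ?thesis"
  hence l: "\<bar>l\<bar> > B + 1" by simp
  have "V \<noteq> {}" using w(2) by auto
  then obtain v where "v \<in> V" by auto
  hence "B \<ge> 0" using V[of v] by simp
  have "\<bar>l\<bar> = \<bar>\<Sum>v\<in>V. w v / (l - v)\<bar>" using assms(4) by simp
  also have "\<dots> \<le> (\<Sum>v\<in>V. w v)"
  proof (rule sum_norm_le[where f = "\<lambda>v. w v / (l - v)", unfolded real_norm_def])
    fix v assume v: "v \<in> V"
    have "\<bar>l - v\<bar> \<ge> 1" using l V[OF v] by linarith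
    thus "\<bar>w v / (l - v)\<bar> \<le> w v"
      using w(1)[OF v] by (simp add: abs_divide divide_le_eq mult_le_cancel_left1)
  qed
  finally show False using w(2) l \<open>B \<ge> 0\<close> by simp
qed

subsection \<open>Compactly supported measures\<close>

lemma real_distribution_iff: "real_distribution M \<longleftrightarrow> prob_space M \<and> sets M = sets borel"
  by (auto simp: real_distribution_def real_distribution_axioms_def)

text \<open>An almost sure bound is the form in which compact support enters integrability and limit
  arguments. For the converse, \<open>{-K..K}\<close> serves as the compact set.\<close>

lemma cpm_iff: "cpm M \<longleftrightarrow> real_distribution M \<and> (\<exists>K. AE x in M. \<bar>x\<bar> \<le> K)"
proof
  assume M: "cpm M"
  then interpret real_distribution M by (simp add: cpm_def real_distribution_iff)
  from M obtain K where K: "compact K" "K \<in> sets M" "emeasure M (space M - K) = 0"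
    by (auto simp: cpm_def compact_support_def)
  obtain B where B: "\<And>x. x \<in> K \<Longrightarrow> \<bar>x\<bar> \<le> B"
    using compact_imp_bounded[OF K(1)] by (auto simp: bounded_iff)
  have "AE x in M. \<bar>x\<bar> \<le> B"
    by (rule AE_I[OF _ K(3)]) (use B K(2) in auto)
  thus "real_distribution M \<and> (\<exists>K. AE x in M. \<bar>x\<bar> \<le> K)" using real_distribution_axioms by blast
next
  assume "real_distribution M \<and> (\<exists>K. AE x in M. \<bar>x\<bar> \<le> K)"
  then obtain K where M: "real_distribution M" and K: "AE x in M. \<bar>x\<bar> \<le> K" by blast
  from M interpret real_distribution M .
  have "AE x in M. x \<in> {-K..K}" using K by eventually_elim auto
  hence "emeasure M (space M - {-K..K}) = 0"
    by (subst (asm) AE_iff_measurable[OF _ refl]) (auto simp: Collect_neg_eq[symmetric] set_diff_eq)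
  thus "cpm M" using prob_space_axioms
    by (auto simp: cpm_def compact_support_def intro!: exI[of _ "{-K..K}"])
qed

lemma (in real_distribution) integrable_bounded_on_support:
  fixes f :: "real \<Rightarrow> 'b::{banach, second_countable_topology}"
  assumes K: "AE x in M. \<bar>x\<bar> \<le> K" and f: "continuous_on UNIV f"
  shows "integrable M f"
proof -
  have "compact (f ` {-K..K})"
    by (intro compact_continuous_image continuous_on_subset[OF f]) auto
  then obtain B where B: "\<And>x. x \<in> {-K..K} \<Longrightarrow> norm (f x) \<le> B"
    using compact_imp_bounded by (fastforce simp: bounded_iff)
  have "AE x in M. norm (f x) \<le> B" using K by eventually_elim (rule B, auto)
  moreover have "f \<in> borel_measurable M"
    using borel_measurable_continuous_onI[OF f] by simp
  ultimately show ?thesis by (intro integrable_const_bound)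
qed

lemma continuous_inverse_linear:
  assumes "Im z \<noteq> 0"
  shows "continuous_on UNIV (\<lambda>x. 1 / (z - complex_of_real x))"
  using assms by (intro continuous_intros) auto

section \<open>From the Cauchy transform to the moments and the measure\<close>

text \<open>Integrate the finite geometric expansion of \<open>1 / (z - x)\<close> in powers of
  \<open>x / z\<close>. The remainder is controlled by
  \<open>\<bar>Im z\<bar> \<le> cmod (z - x)\<close>, so \<open>E\<close> tends to 0 as
  \<open>\<bar>Im z\<bar>\<close> grows.\<close>

lemma (in real_distribution) cauchy_transform_expansion:
  assumes K: "AE x in M. \<bar>x\<bar> \<le> K" and z: "Im z \<noteq> 0"
  obtains E where "cauchy_transform M z = (\<Sum>j\<le>n. complex_of_real (moment M j) / z ^ Suc j) + E / z ^ Suc n"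
    and "cmod E \<le> K ^ Suc n / \<bar>Im z\<bar>"
proof -
  have z0: "z \<noteq> 0" using z by auto
  have zx: "z - complex_of_real x \<noteq> 0" for x using z by (auto simp: complex_eq_iff)
  define e where "e x = complex_of_real x ^ Suc n / (z - complex_of_real x)" for x
  have ident: "1 / (z - complex_of_real x) = (\<Sum>j\<le>n. complex_of_real (x ^ j) / z ^ Suc j) + e x / z ^ Suc n" for x
    unfolding e_def
  proof (induction n)
    case 0
    show ?case using z0 zx[of x] by (simp add: field_simps)
  next
    case (Suc n)
    have "complex_of_real x ^ Suc n / (z - complex_of_real x) / z ^ Suc n =
        complex_of_real (x ^ Suc n) / z ^ Suc (Suc n) +
        complex_of_real x ^ Suc (Suc n) / (z - complex_of_real x) / z ^ Suc (Suc n)"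
      using z0 zx[of x] by (simp add: divide_simps) (simp add: algebra_simps)
    thus ?case using Suc by simp
  qed
  have cont_e: "continuous_on UNIV e"
    unfolding e_def using zx by (intro continuous_intros) auto
  have int_e: "integrable M e" by (rule integrable_bounded_on_support[OF K cont_e])
  have int_p: "integrable M (\<lambda>x. complex_of_real (x ^ j))" for j
    by (rule integrable_bounded_on_support[OF K]) (intro continuous_intros)
  have mom: "(\<integral>x. complex_of_real (x ^ j) \<partial>M) = complex_of_real (moment M j)" for j
    unfolding moment_def by (rule integral_complex_of_real)
  show ?thesis
  proof (rule that[of "\<integral>x. e x \<partial>M"])
    show "cauchy_transform M z = (\<Sum>j\<le>n. complex_of_real (moment M j) / z ^ Suc j) +
        (\<integral>x. e x \<partial>M) / z ^ Suc n"
      unfolding cauchy_transform_def ident mom[symmetric]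
      using int_e int_p by (simp del: of_real_power power_Suc)
    have "AE x in M. cmod (e x) \<le> K ^ Suc n / \<bar>Im z\<bar>"
      using K
    proof eventually_elim
      case (elim x)
      have "\<bar>Im z\<bar> \<le> cmod (z - complex_of_real x)"
        using abs_Im_le_cmod[of "z - complex_of_real x"] by simp
      moreover have "\<bar>x\<bar> ^ Suc n \<le> K ^ Suc n" using elim by (intro power_mono) auto
      ultimately show ?case
        unfolding e_def norm_divide norm_power norm_of_real using z elim
        by (intro frac_le) auto
    qed
    hence "cmod (\<integral>x. e x \<partial>M) \<le> (\<integral>x. K ^ Suc n / \<bar>Im z\<bar> \<partial>M)"
      using int_e by (intro order_trans[OF integral_norm_bound] integral_mono_AE) auto
    thus "cmod (\<integral>x. e x \<partial>M) \<le> K ^ Suc n / \<bar>Im z\<bar>"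
      using prob_space by simp
  qed
qed

text \<open>Once the lower moments agree, they cancel from the two expansions. What remains,
  multiplied by \<open>z ^ Suc k\<close>, bounds the difference of the \<open>k\<close>-th moments
  by a constant over \<open>\<bar>Im z\<bar>\<close>; let \<open>z\<close> go to infinity along the
  imaginary axis.\<close>

lemma cauchy_transform_moments_eq:
  assumes M: "cpm M" "cpm M'"
    and eq: "\<And>z. Im z \<noteq> 0 \<Longrightarrow> cauchy_transform M z = cauchy_transform M' z"
  shows "moment M k = moment M' k"
proof (induction k rule: less_induct)
  case (less k)
  from M obtain K K' where M': "real_distribution M" "AE x in M. \<bar>x\<bar> \<le> K"
    "real_distribution M'" "AE x in M'. \<bar>x\<bar> \<le> K'" by (auto simp: cpm_iff)
  have bound: "\<bar>moment M k - moment M' k\<bar> \<le> (K ^ Suc k + K' ^ Suc k) / n" if n: "n > 0" for n :: nat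
  proof -
    define z where "z = \<i> * of_nat n"
    have z: "Im z \<noteq> 0" "z \<noteq> 0" using n by (auto simp: z_def)
    obtain E where E: "cauchy_transform M z = (\<Sum>j\<le>k. complex_of_real (moment M j) / z ^ Suc j) + E / z ^ Suc k"
      "cmod E \<le> K ^ Suc k / \<bar>Im z\<bar>"
      by (rule real_distribution.cauchy_transform_expansion[OF M'(1,2) z(1)])
    obtain E' where E': "cauchy_transform M' z = (\<Sum>j\<le>k. complex_of_real (moment M' j) / z ^ Suc j) + E' / z ^ Suc k"
      "cmod E' \<le> K' ^ Suc k / \<bar>Im z\<bar>"
      by (rule real_distribution.cauchy_transform_expansion[OF M'(3,4) z(1)])
    have split: "(\<Sum>j\<le>k. f j) = (\<Sum>j<k. f j) + f k" for f :: "nat \<Rightarrow> complex"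
      by (simp add: lessThan_Suc_atMost[symmetric])
    have "(\<Sum>j<k. complex_of_real (moment M j) / z ^ Suc j) = (\<Sum>j<k. complex_of_real (moment M' j) / z ^ Suc j)"
      using less by (intro sum.cong) auto
    hence "(complex_of_real (moment M k) + E) / z ^ Suc k = (complex_of_real (moment M' k) + E') / z ^ Suc k"
      using E(1) E'(1) eq[OF z(1)] unfolding split by (simp add: add_divide_distrib add.assoc)
    hence "complex_of_real (moment M k) + E = complex_of_real (moment M' k) + E'"
      using z(2) by simp
    hence "complex_of_real (moment M k - moment M' k) = E' - E"
      by (simp add: algebra_simps)
    hence "\<bar>moment M k - moment M' k\<bar> = cmod (E' - E)"
      by (metis norm_of_real)
    also have "\<dots> \<le> cmod E' + cmod E" by (rule norm_triangle_ineq4)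
    also have "\<dots> \<le> K' ^ Suc k / n + K ^ Suc k / n" using E(2) E'(2) by (intro add_mono) (auto simp: z_def)
    finally show ?thesis by (simp add: add_divide_distrib)
  qed
  have "\<bar>moment M k - moment M' k\<bar> \<le> 0"
  proof (rule LIMSEQ_le_const[OF lim_const_over_n])
    show "\<exists>N. \<forall>n\<ge>N. \<bar>moment M k - moment M' k\<bar> \<le> (K ^ Suc k + K' ^ Suc k) / real n"
      using bound by (intro exI[of _ 1]) auto
  qed
  thus ?case by simp
qed

text \<open>Absolute moments grow at most like \<open>K ^ n\<close>, so the Taylor polynomials of
  the characteristic function, whose coefficients are moments, converge to it everywhere. Equal
  characteristic functions give equal measures.\<close>

lemma moments_determine_cpm:
  assumes "cpm M" "cpm M'" and eq: "\<And>k. moment M k = moment M' k"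
  shows "M = M'"
proof -
  have char: "(\<lambda>n. \<Sum>k\<le>n. ((\<i> * t) ^ k / fact k) * complex_of_real (moment N k)) \<longlonglongrightarrow> char N t"
    if "cpm N" for N t
  proof -
    from that obtain K where N: "real_distribution N" "AE x in N. \<bar>x\<bar> \<le> K" by (auto simp: cpm_iff)
    interpret real_distribution N by fact
    have int: "integrable N (\<lambda>x. x ^ k)" for k
      by (rule integrable_bounded_on_support[OF N(2)]) (intro continuous_intros)
    have le: "norm ((\<Sum>k\<le>n. ((\<i> * t) ^ k / fact k) * complex_of_real (moment N k)) - char N t)
        \<le> 2 * ((\<bar>t\<bar> * K) ^ n / fact n)" for n
    proof -
      have "expectation (\<lambda>x. \<bar>x\<bar> ^ n) \<le> expectation (\<lambda>x. K ^ n)"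
      proof (rule integral_mono_AE)
        show "integrable N (\<lambda>x. \<bar>x\<bar> ^ n)"
          by (rule integrable_bounded_on_support[OF N(2)]) (intro continuous_intros)
        show "AE x in N. \<bar>x\<bar> ^ n \<le> K ^ n" using N(2) by eventually_elim (intro power_mono, auto)
      qed simp
      hence "expectation (\<lambda>x. \<bar>x\<bar> ^ n) \<le> K ^ n" using prob_space by simp
      hence "(2 * \<bar>t\<bar> ^ n / fact n) * expectation (\<lambda>x. \<bar>x\<bar> ^ n) \<le> (2 * \<bar>t\<bar> ^ n / fact n) * K ^ n"
        by (intro mult_left_mono) auto
      moreover have "cmod (char N t - (\<Sum>k\<le>n. ((\<i> * t) ^ k / fact k) * complex_of_real (moment N k)))
          \<le> (2 * \<bar>t\<bar> ^ n / fact n) * expectation (\<lambda>x. \<bar>x\<bar> ^ n)"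
        using char_approx1[where n = n and t = t, OF int] by (simp only: moment_def)
      ultimately show ?thesis
        by (simp add: norm_minus_commute power_mult_distrib)
    qed
    have "(\<lambda>n. (\<bar>t\<bar> * K) ^ n / fact n) \<longlonglongrightarrow> 0"
      using summable_LIMSEQ_zero[OF summable_exp[of "\<bar>t\<bar> * K"]] by (simp add: field_simps)
    hence "(\<lambda>n. 2 * ((\<bar>t\<bar> * K) ^ n / fact n)) \<longlonglongrightarrow> 0"
      using tendsto_mult_right_zero by blast
    hence "(\<lambda>n. (\<Sum>k\<le>n. ((\<i> * t) ^ k / fact k) * complex_of_real (moment N k)) - char N t) \<longlonglongrightarrow> 0"
      by (rule Lim_null_comparison[rotated]) (use le in auto)
    thus ?thesis by (simp add: LIM_zero_iff)
  qed
  have "char M = char M'"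
  proof
    fix t
    show "char M t = char M' t"
      using char[OF assms(1), of t] char[OF assms(2), of t] unfolding eq by (rule LIMSEQ_unique)
  qed
  thus ?thesis using assms by (intro Levy_uniqueness) (auto simp: cpm_iff)
qed

section \<open>Weak limits of measures on a common interval\<close>

text \<open>A common bounded support gives tightness, hence a weakly convergent subsequence.
  Integrals then converge even for unbounded continuous functions, since only their values on
  \<open>{-K..K}\<close> matter.\<close>

lemma weak_limit_bounded_support:
  assumes \<mu>: "\<And>n. real_distribution (\<mu> n)" and K: "\<And>n. AE x in \<mu> n. \<bar>x\<bar> \<le> K"
  obtains r M where "strict_mono (r :: nat \<Rightarrow> nat)" "real_distribution M" "AE x in M. \<bar>x\<bar> \<le> K"
    "\<And>f :: real \<Rightarrow> complex. continuous_on UNIV f \<Longrightarrow>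
       (\<lambda>n. \<integral>x. f x \<partial>\<mu> (r n)) \<longlonglongrightarrow> (\<integral>x. f x \<partial>M)"
proof -
  have K0: "K \<ge> 0"
  proof (rule ccontr)
    assume "\<not> K \<ge> 0"
    have "AE x in \<mu> 0. False" using K[of 0] by eventually_elim (use \<open>\<not> K \<ge> 0\<close> in auto)
    thus False using prob_space.AE_False real_distribution.axioms(1)[OF \<mu>[of 0]] by blast
  qed
  have "tight \<mu>"
    unfolding tight_def
  proof (intro conjI allI impI)
    fix \<epsilon> :: real assume "\<epsilon> > 0"
    \<comment> \<open>Tightness is phrased with half-open intervals, so the left end is moved below
      \<open>-K\<close> to keep a possible atom there.\<close>
    have "measure (\<mu> n) {-K-1<..K} = 1" for n
    proof -
      interpret real_distribution "\<mu> n" by (rule \<mu>)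
      have "AE x in \<mu> n. x \<in> {-K-1<..K}" using K[of n] by eventually_elim auto
      thus ?thesis by (intro prob_eq_1[THEN iffD2]) auto
    qed
    thus "\<exists>a b. a < b \<and> (\<forall>n. 1 - \<epsilon> < measure (\<mu> n) {a<..b})"
      using K0 \<open>\<epsilon> > 0\<close> by (intro exI[of _ "-K-1"] exI[of _ K]) auto
  qed (rule \<mu>)
  from tight_imp_convergent_subsubsequence[OF this strict_mono_id]
  obtain r M where r: "strict_mono (r :: nat \<Rightarrow> nat)" and M: "real_distribution M"
    and conv: "weak_conv_m (\<lambda>n. \<mu> (r n)) M" by (auto simp: o_def)
  have lim: "(\<lambda>n. \<integral>x. f x \<partial>\<mu> (r n)) \<longlonglongrightarrow> (\<integral>x. f x \<partial>M)"
    if "\<And>x. isCont f x" "\<And>x. norm (f x) \<le> B" for f :: "real \<Rightarrow> complex" and B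
    by (rule weak_conv_imp_integral_bdd_continuous_conv[OF \<mu> M conv that])
  interpret M: real_distribution M by (rule M)
  have AE_M: "AE x in M. \<bar>x\<bar> \<le> K"
  proof -
    \<comment> \<open>A bounded continuous test function that vanishes exactly on
      \<open>{-K..K}\<close>: its integrals along the sequence are 0, hence so is the one against
      the limit.\<close>
    define f where "f x = max 0 (min 1 (\<bar>x\<bar> - K))" for x
    have cont: "isCont f x" for x unfolding f_def by (intro continuous_intros)
    have bd: "norm (f x) \<le> 1" for x by (auto simp: f_def)
    have meas: "f \<in> borel_measurable borel" unfolding f_def by measurable
    have "(\<lambda>n. \<integral>x. f x \<partial>\<mu> (r n)) \<longlonglongrightarrow> (\<integral>x. f x \<partial>M)"
      by (rule weak_conv_imp_integral_bdd_continuous_conv[OF \<mu> M conv cont bd])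
    moreover have "(\<integral>x. f x \<partial>\<mu> (r n)) = 0" for n
    proof -
      have "AE x in \<mu> (r n). f x = 0" using K[of "r n"] by eventually_elim (auto simp: f_def)
      thus ?thesis by (rule integral_eq_zero_AE)
    qed
    ultimately have "(\<integral>x. f x \<partial>M) = 0" by (simp add: LIMSEQ_const_iff)
    moreover have "integrable M f"
      by (rule M.integrable_const_bound[where B = 1]) (use bd meas in auto)
    ultimately have "AE x in M. f x = 0"
      by (subst (asm) integral_nonneg_eq_0_iff_AE) (auto simp: f_def)
    thus ?thesis by eventually_elim (auto simp: f_def max_def min_def split: if_splits)
  qed
  show ?thesis
  proof (rule that[OF r M AE_M])
    fix f :: "real \<Rightarrow> complex" assume f: "continuous_on UNIV f"
    \<comment> \<open>Clamping the argument to \<open>{-K..K}\<close> gives a bounded continuous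
      function that agrees with \<open>f\<close> almost surely for all measures involved.\<close>
    define g where "g x = f (max (- K) (min K x))" for x
    have contg: "continuous_on UNIV g"
      unfolding g_def by (intro continuous_on_compose2[OF f]) (auto intro!: continuous_intros)
    hence cont: "isCont g x" for x by (simp add: continuous_on_eq_continuous_at)
    have "compact (f ` {-K..K})"
      by (intro compact_continuous_image continuous_on_subset[OF f]) auto
    then obtain B where B: "\<And>x. x \<in> {-K..K} \<Longrightarrow> norm (f x) \<le> B"
      using compact_imp_bounded by (fastforce simp: bounded_iff)
    have bd: "norm (g x) \<le> B" for x unfolding g_def using K0 by (intro B) auto
    have gf: "(\<integral>x. f x \<partial>N) = (\<integral>x. g x \<partial>N)" if "real_distribution N" "AE x in N. \<bar>x\<bar> \<le> K" for N
    proof (rule integral_cong_AE)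
      interpret real_distribution N by fact
      show "f \<in> borel_measurable N" "g \<in> borel_measurable N"
        using borel_measurable_continuous_onI[OF f] borel_measurable_continuous_onI[OF contg] by auto
      show "AE x in N. f x = g x"
        using that(2) by eventually_elim (auto simp: g_def max_def min_def)
    qed
    show "(\<lambda>n. \<integral>x. f x \<partial>\<mu> (r n)) \<longlonglongrightarrow> (\<integral>x. f x \<partial>M)"
      unfolding gf[OF \<mu> K] gf[OF M AE_M] by (rule lim[OF cont bd])
  qed
qed

section \<open>Existence of the measure with reciprocal Cauchy transform\<close>

lemma (in real_distribution) integral_finite_range:
  fixes f :: "real \<Rightarrow> complex"
  assumes h: "h \<in> borel_measurable M" and A: "finite A" and AE: "AE x in M. h x \<in> A"
    and f: "continuous_on UNIV f"
  shows "(\<integral>x. f (h x) \<partial>M) = (\<Sum>v\<in>A. complex_of_real (prob (h -` {v})) * f v)"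
proof -
  have ms: "h -` {v} \<in> sets M" for v
    using measurable_sets[OF h, of "{v}"] by simp
  have "(\<integral>x. f (h x) \<partial>M) = (\<integral>x. (\<Sum>v\<in>A. indicat_real (h -` {v}) x *\<^sub>R f v) \<partial>M)"
  proof (rule integral_cong_AE)
    show "(\<lambda>x. f (h x)) \<in> borel_measurable M"
      using measurable_compose[OF h borel_measurable_continuous_onI[OF f]] .
    show "(\<lambda>x. \<Sum>v\<in>A. indicat_real (h -` {v}) x *\<^sub>R f v) \<in> borel_measurable M"
      using ms by (intro borel_measurable_sum borel_measurable_scaleR borel_measurable_indicator) auto
    show "AE x in M. f (h x) = (\<Sum>v\<in>A. indicat_real (h -` {v}) x *\<^sub>R f v)"
      using AE
    proof eventually_elim
      case (elim x)
      have "(\<Sum>v\<in>A. indicat_real (h -` {v}) x *\<^sub>R f v) = (\<Sum>v\<in>A. if v = h x then f v else 0)"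
        by (intro sum.cong) (auto simp: indicator_def)
      thus ?case using elim A by simp
    qed
  qed
  also have "\<dots> = (\<Sum>v\<in>A. \<integral>x. indicat_real (h -` {v}) x *\<^sub>R f v \<partial>M)"
    using ms by (intro Bochner_Integration.integral_sum integrable_scaleR_left)
      (auto intro!: integrable_real_indicator simp: emeasure_eq_measure)
  also have "\<dots> = (\<Sum>v\<in>A. complex_of_real (prob (h -` {v})) * f v)"
    using ms by (intro sum.cong refl) (simp add: scaleR_conv_of_real emeasure_eq_measure)
  finally show ?thesis .
qed

lemma discrete_distribution:
  fixes c :: "real \<Rightarrow> real"
  assumes \<Lambda>: "finite \<Lambda>" and c: "\<And>l. l \<in> \<Lambda> \<Longrightarrow> c l \<ge> 0" and sum: "sum c \<Lambda> = 1"
  obtains M where "real_distribution M" "AE x in M. x \<in> \<Lambda>"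
    "\<And>f :: real \<Rightarrow> complex. continuous_on UNIV f \<Longrightarrow>
       (\<integral>x. f x \<partial>M) = (\<Sum>l\<in>\<Lambda>. complex_of_real (c l) * f l)"
proof -
  define Q where "Q = point_measure \<Lambda> (\<lambda>l. ennreal (c l))"
  have meas: "(\<lambda>x. x) \<in> measurable Q borel" by (simp add: Q_def)
  have "emeasure Q (space Q) = 1"
    using \<Lambda> c sum by (simp add: Q_def emeasure_point_measure_finite space_point_measure)
  then interpret Q: prob_space Q by (rule prob_spaceI)
  show ?thesis
  \<comment> \<open>The point measure lives on the power set of \<open>\<Lambda>\<close>; its image
    under the inclusion is a measure on the Borel sets of the line.\<close>
  proof (rule that[of "distr Q borel (\<lambda>x. x)"])
    show "real_distribution (distr Q borel (\<lambda>x. x))"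
      by (rule Q.real_distribution_distr[OF meas])
    show "AE x in distr Q borel (\<lambda>x. x). x \<in> \<Lambda>"
      using meas \<Lambda> by (subst AE_distr_iff) (auto simp: Q_def space_point_measure intro!: borel_closed finite_imp_closed)
    show "(\<integral>x. f x \<partial>distr Q borel (\<lambda>x. x)) = (\<Sum>l\<in>\<Lambda>. complex_of_real (c l) * f l)"
      if "continuous_on UNIV f" for f :: "real \<Rightarrow> complex"
      using integral_distr[OF meas borel_measurable_continuous_onI[OF that]]
        lebesgue_integral_point_measure_finite[where g = f, OF \<Lambda> c]
      by (simp add: Q_def scaleR_conv_of_real)
  qed
qed

text \<open>The finite sums of the discrete construction are rewritten as integrals against
  \<open>\<rho>\<close> and \<open>\<mu>\<close>. They are complex-valued, so the limit theorem for
  complex continuous functions applies to each of them.\<close>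

lemma finite_range_reciprocal:
  assumes "real_distribution \<rho>" and h: "h \<in> borel_measurable \<rho>" and A: "finite A"
    and AE: "AE x in \<rho>. h x \<in> A" and B: "\<And>v. v \<in> A \<Longrightarrow> \<bar>v\<bar> \<le> B"
  shows "\<exists>\<mu>. real_distribution \<mu> \<and> (AE x in \<mu>. \<bar>x\<bar> \<le> B + 1) \<and>
    (\<forall>z. Im z \<noteq> 0 \<longrightarrow> (z - (\<integral>x. 1 / (z - complex_of_real (h x)) \<partial>\<rho>)) * (\<integral>x. 1 / (z - complex_of_real x) \<partial>\<mu>) = 1) \<and>
    (\<integral>x. complex_of_real x \<partial>\<mu>) = 0 \<and>
    (\<forall>m. (\<integral>x. complex_of_real x ^ (m + 2) \<partial>\<mu>) =
      (\<Sum>p\<le>m. (\<integral>x. complex_of_real (h x) ^ p \<partial>\<rho>) * (\<integral>x. complex_of_real x ^ (m - p) \<partial>\<mu>)))"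
proof -
  interpret \<rho>: real_distribution \<rho> by fact
  define w where "w v = \<rho>.prob (h -` {v})" for v
  \<comment> \<open>Values of probability 0 are discarded, because
    \<open>discrete_reciprocal\<close> needs strictly positive weights.\<close>
  define V where "V = {v \<in> A. w v > 0}"
  have finV: "finite V" using A by (simp add: V_def)
  have int: "(\<integral>x. f (h x) \<partial>\<rho>) = (\<Sum>v\<in>V. complex_of_real (w v) * f v)"
    if "continuous_on UNIV f" for f
    unfolding \<rho>.integral_finite_range[OF h A AE that] w_def[symmetric] V_def
    using A by (intro sum.mono_neutral_right) (auto simp: w_def measure_le_0_iff not_less)
  have "complex_of_real (sum w V) = complex_of_real 1"
    using int[of "\<lambda>_. 1"] \<rho>.prob_space by simp
  hence sumw: "sum w V = 1" by (simp only: of_real_eq_iff)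
  hence V0: "V \<noteq> {}" by auto
  have wpos: "w v > 0" if "v \<in> V" for v using that by (simp add: V_def)
  from discrete_reciprocal[where w = w, OF finV V0 wpos]
  obtain \<Lambda> c where L': "finite \<Lambda>" "\<forall>l\<in>\<Lambda>. c l \<ge> 0" "sum c \<Lambda> = 1" "\<Lambda> \<inter> V = {}"
    "\<forall>l\<in>\<Lambda>. l = (\<Sum>v\<in>V. w v / (l - v))"
    "\<forall>v\<in>V. (\<Sum>l\<in>\<Lambda>. c l / (v - l)) = 0"
    "\<forall>z. Im z \<noteq> 0 \<longrightarrow> (z - (\<Sum>v\<in>V. complex_of_real (w v) / (z - complex_of_real v))) *
       (\<Sum>l\<in>\<Lambda>. complex_of_real (c l) / (z - complex_of_real l)) = 1"
    by blast
  note L = L'[rule_format]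
  obtain \<mu> where \<mu>: "real_distribution \<mu>" "AE x in \<mu>. x \<in> \<Lambda>"
    "\<And>f :: real \<Rightarrow> complex. continuous_on UNIV f \<Longrightarrow>
       (\<integral>x. f x \<partial>\<mu>) = (\<Sum>l\<in>\<Lambda>. complex_of_real (c l) * f l)"
    by (rule discrete_distribution[where c = c, OF L(1) _ L(3)]) (erule L(2), rule that, (assumption | blast)+)
  note rec = discrete_moment_recursion[OF L(4-6)]
  have "AE x in \<mu>. \<bar>x\<bar> \<le> B + 1"
    using \<mu>(2)
  proof eventually_elim
    case (elim x)
    show ?case
      by (rule discrete_reciprocal_bounded[OF _ sumw _ L(5)[OF elim]])
         (auto simp: V_def intro: B)
  qed
  moreover have "(z - (\<integral>x. 1 / (z - complex_of_real (h x)) \<partial>\<rho>)) * (\<integral>x. 1 / (z - complex_of_real x) \<partial>\<mu>) = 1"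
    if "Im z \<noteq> 0" for z
    using L(7)[OF that] int[OF continuous_inverse_linear[OF that]] \<mu>(3)[OF continuous_inverse_linear[OF that]]
    by simp
  moreover have "(\<integral>x. complex_of_real x \<partial>\<mu>) = 0"
  proof -
    have "(\<integral>x. complex_of_real x \<partial>\<mu>) = complex_of_real (\<Sum>l\<in>\<Lambda>. c l * l)"
      by (subst \<mu>(3)) (auto intro!: continuous_intros)
    thus ?thesis using rec(1) by simp
  qed
  moreover have "(\<integral>x. complex_of_real x ^ (m + 2) \<partial>\<mu>) =
      (\<Sum>p\<le>m. (\<integral>x. complex_of_real (h x) ^ p \<partial>\<rho>) * (\<integral>x. complex_of_real x ^ (m - p) \<partial>\<mu>))" for m
  proof -
    have 1: "(\<integral>x. complex_of_real x ^ k \<partial>\<mu>) = complex_of_real (\<Sum>l\<in>\<Lambda>. c l * l ^ k)" for k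
      by (subst \<mu>(3)) (auto intro!: continuous_intros)
    have 2: "(\<integral>x. complex_of_real (h x) ^ k \<partial>\<rho>) = complex_of_real (\<Sum>v\<in>V. w v * v ^ k)" for k
      by (subst int[of "\<lambda>x. complex_of_real x ^ k"]) (auto intro!: continuous_intros)
    show ?thesis unfolding 1 2 using rec(2)[of m]
      by (simp only: of_real_sum[symmetric] of_real_mult[symmetric])
  qed
  ultimately show ?thesis using \<mu>(1) by blast
qed

text \<open>The transform identity and the moment recursion both hold for the discretisations and
  both involve only integrals of continuous functions, so each passes to the limit on its
  own.\<close>

lemma cauchy_transform_reciprocal:
  assumes "cpm \<rho>"
  obtains \<mu> where "cpm \<mu>"
    "\<And>z. Im z \<noteq> 0 \<Longrightarrow> cauchy_transform \<mu> z = 1 / (z - cauchy_transform \<rho> z)"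
    "moment \<mu> 0 = 1" "moment \<mu> 1 = 0"
    "\<And>m. moment \<mu> (m + 2) = (\<Sum>p\<le>m. moment \<rho> p * moment \<mu> (m - p))"
proof -
  from assms obtain K where \<rho>: "real_distribution \<rho>" and K: "AE x in \<rho>. \<bar>x\<bar> \<le> K"
    by (auto simp: cpm_iff)
  interpret \<rho>: real_distribution \<rho> by fact
  \<comment> \<open>Rounding down to the grid of mesh \<open>1 / Suc n\<close>. The rounded value
    may fall below \<open>-K\<close> by at most one mesh width, hence the bound \<open>K + 1\<close>
    for \<open>h\<close> and for the grid points in \<open>A n\<close>.\<close>
  define h where "h n x = of_int \<lfloor>real (Suc n) * x\<rfloor> / real (Suc n)" for n x
  define A where "A n = (\<lambda>j. of_int j / real (Suc n)) ` {\<lfloor>- (real (Suc n) * K)\<rfloor>..\<lfloor>real (Suc n) * K\<rfloor>}" for n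
  have h_le: "h n x \<le> x" "x - 1 / real (Suc n) \<le> h n x" for n x
  proof -
    have "of_int \<lfloor>real (Suc n) * x\<rfloor> \<le> real (Suc n) * x" by (rule of_int_floor_le)
    thus "h n x \<le> x" unfolding h_def by (subst pos_divide_le_eq) (auto simp: mult.commute)
    have "real (Suc n) * x - 1 \<le> of_int \<lfloor>real (Suc n) * x\<rfloor>" by linarith
    hence "(real (Suc n) * x - 1) / real (Suc n) \<le> h n x"
      unfolding h_def by (intro divide_right_mono) auto
    thus "x - 1 / real (Suc n) \<le> h n x" by (simp add: diff_divide_distrib del: of_nat_Suc)
  qed
  have h_meas: "h n \<in> borel_measurable \<rho>" for n
    unfolding h_def by measurable
  have h_bd: "\<bar>h n x\<bar> \<le> K + 1" if "\<bar>x\<bar> \<le> K" for n x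
  proof -
    have "1 / real (Suc n) \<le> 1" by simp
    thus ?thesis using h_le(1)[of n x] h_le(2)[of x n] that by linarith
  qed
  have h_A: "AE x in \<rho>. h n x \<in> A n" for n
    using K
  proof eventually_elim
    case (elim x)
    have "- (real (Suc n) * K) \<le> real (Suc n) * x" "real (Suc n) * x \<le> real (Suc n) * K"
      using elim mult_left_mono[of "- K" x "real (Suc n)"] mult_left_mono[of x K "real (Suc n)"]
      by (auto simp del: of_nat_Suc)
    hence "\<lfloor>real (Suc n) * x\<rfloor> \<in> {\<lfloor>- (real (Suc n) * K)\<rfloor>..\<lfloor>real (Suc n) * K\<rfloor>}"
      by (auto intro: floor_mono)
    thus ?case unfolding A_def h_def by (rule imageI)
  qed
  have A_bd: "\<bar>v\<bar> \<le> K + 1" if v: "v \<in> A n" for v n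
  proof -
    obtain j where j: "v = of_int j / real (Suc n)"
      "\<lfloor>- (real (Suc n) * K)\<rfloor> \<le> j" "j \<le> \<lfloor>real (Suc n) * K\<rfloor>" using v by (auto simp: A_def)
    have "of_int j \<le> real (Suc n) * K" "- (real (Suc n) * K) - 1 \<le> of_int j" using j(2,3) by linarith+
    moreover have "real (Suc n) * (K + 1) = real (Suc n) * K + real (Suc n)" by (simp add: distrib_left)
    ultimately have "\<bar>of_int j\<bar> \<le> real (Suc n) * (K + 1)" by linarith
    thus ?thesis unfolding j(1) by (simp add: abs_divide pos_divide_le_eq mult.commute del: of_nat_Suc)
  qed
  have "\<forall>n. \<exists>\<mu>. real_distribution \<mu> \<and> (AE x in \<mu>. \<bar>x\<bar> \<le> (K + 1) + 1) \<and>
    (\<forall>z. Im z \<noteq> 0 \<longrightarrow> (z - (\<integral>x. 1 / (z - complex_of_real (h n x)) \<partial>\<rho>)) * (\<integral>x. 1 / (z - complex_of_real x) \<partial>\<mu>) = 1) \<and>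
    (\<integral>x. complex_of_real x \<partial>\<mu>) = 0 \<and>
    (\<forall>m. (\<integral>x. complex_of_real x ^ (m + 2) \<partial>\<mu>) =
      (\<Sum>p\<le>m. (\<integral>x. complex_of_real (h n x) ^ p \<partial>\<rho>) * (\<integral>x. complex_of_real x ^ (m - p) \<partial>\<mu>)))"
    by (intro allI finite_range_reciprocal[OF \<rho> h_meas _ h_A A_bd]) (auto simp: A_def)
  from choice[OF this] obtain \<mu> where \<mu>: "\<And>n. real_distribution (\<mu> n)"
    "\<And>n. AE x in \<mu> n. \<bar>x\<bar> \<le> (K + 1) + 1"
    and ct: "\<And>n z. Im z \<noteq> 0 \<Longrightarrow> (z - (\<integral>x. 1 / (z - complex_of_real (h n x)) \<partial>\<rho>)) * (\<integral>x. 1 / (z - complex_of_real x) \<partial>\<mu> n) = 1"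
    and m1: "\<And>n. (\<integral>x. complex_of_real x \<partial>\<mu> n) = 0"
    and rec: "\<And>n m. (\<integral>x. complex_of_real x ^ (m + 2) \<partial>\<mu> n) =
      (\<Sum>p\<le>m. (\<integral>x. complex_of_real (h n x) ^ p \<partial>\<rho>) * (\<integral>x. complex_of_real x ^ (m - p) \<partial>\<mu> n))"
    by blast
  obtain r M where r: "strict_mono (r :: nat \<Rightarrow> nat)" and M: "real_distribution M" "AE x in M. \<bar>x\<bar> \<le> (K + 1) + 1"
    and lim: "\<And>f :: real \<Rightarrow> complex. continuous_on UNIV f \<Longrightarrow>
       (\<lambda>n. \<integral>x. f x \<partial>\<mu> (r n)) \<longlonglongrightarrow> (\<integral>x. f x \<partial>M)"
    by (rule weak_limit_bounded_support[where \<mu> = \<mu>, OF \<mu>]) (rule that, (assumption | blast)+)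
  interpret M: real_distribution M by fact
  \<comment> \<open>On the side of \<open>\<rho>\<close> the limit is dominated convergence:
    \<open>h n x\<close> tends to \<open>x\<close> pointwise and stays in a compact
    interval.\<close>
  have lim\<rho>: "(\<lambda>n. \<integral>x. f (h (r n) x) \<partial>\<rho>) \<longlonglongrightarrow> (\<integral>x. f x \<partial>\<rho>)"
    if f: "continuous_on UNIV f" for f :: "real \<Rightarrow> complex"
  proof -
    have "compact (f ` {-(K+1)..K+1})"
      by (intro compact_continuous_image continuous_on_subset[OF f]) auto
    then obtain C where C: "\<And>x. x \<in> {-(K+1)..K+1} \<Longrightarrow> norm (f x) \<le> C"
      using compact_imp_bounded by (fastforce simp: bounded_iff)
    have f_meas: "f \<in> borel_measurable borel" using f by (rule borel_measurable_continuous_onI)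
    have "(\<lambda>n. \<integral>x. f (h n x) \<partial>\<rho>) \<longlonglongrightarrow> (\<integral>x. f x \<partial>\<rho>)"
    proof (rule integral_dominated_convergence[where w = "\<lambda>_. C"])
      show "f \<in> borel_measurable \<rho>" using f_meas by simp
      show "(\<lambda>x. f (h n x)) \<in> borel_measurable \<rho>" for n
        using measurable_compose[OF h_meas f_meas] .
      show "AE x in \<rho>. (\<lambda>n. f (h n x)) \<longlonglongrightarrow> f x"
      proof (rule AE_I2)
        fix x
        have l: "(\<lambda>n. x - 1 / real (Suc n)) \<longlonglongrightarrow> x"
          using tendsto_diff[OF tendsto_const[of x] LIMSEQ_inverse_real_of_nat]
          by (simp add: inverse_eq_divide)
        have "(\<lambda>n. h n x) \<longlonglongrightarrow> x"
          by (rule tendsto_sandwich[OF _ _ l tendsto_const]) (simp_all add: h_le del: of_nat_Suc)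
        moreover have "isCont f x" using f by (simp add: continuous_on_eq_continuous_at)
        ultimately show "(\<lambda>n. f (h n x)) \<longlonglongrightarrow> f x" by (rule isCont_tendsto_compose[rotated])
      qed
      show "AE x in \<rho>. norm (f (h n x)) \<le> C" for n
        using K
      proof eventually_elim
        case (elim x)
        show ?case using h_bd[OF elim, of n] by (intro C) auto
      qed
    qed auto
    from LIMSEQ_subseq_LIMSEQ[OF this r] show ?thesis by (simp add: o_def)
  qed
  have cpow: "continuous_on UNIV (\<lambda>x. complex_of_real x ^ k)" for k by (intro continuous_intros)
  have mom: "(\<integral>x. complex_of_real x ^ k \<partial>N) = complex_of_real (moment N k)" for N k
    unfolding moment_def of_real_power[symmetric] by (rule integral_complex_of_real)
  show ?thesis
  proof (rule that[of M])
    show "cpm M" using M by (auto simp: cpm_iff)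
    show "cauchy_transform M z = 1 / (z - cauchy_transform \<rho> z)" if z: "Im z \<noteq> 0" for z
    proof -
      note c = continuous_inverse_linear[OF z]
      \<comment> \<open>In product form the identity survives the limit directly, and a product
        equal to 1 also shows that the denominator \<open>z - cauchy_transform \<rho> z\<close> is
        nonzero.\<close>
      have "(\<lambda>n. (z - (\<integral>x. 1 / (z - complex_of_real (h (r n) x)) \<partial>\<rho>)) *
          (\<integral>x. 1 / (z - complex_of_real x) \<partial>\<mu> (r n)))
        \<longlonglongrightarrow> (z - cauchy_transform \<rho> z) * cauchy_transform M z"
        unfolding cauchy_transform_def by (intro tendsto_intros lim[OF c] lim\<rho>[OF c])
      hence "(z - cauchy_transform \<rho> z) * cauchy_transform M z = 1"
        unfolding ct[OF z] by (simp add: LIMSEQ_const_iff)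
      thus ?thesis by (metis nonzero_eq_divide_eq mult.commute mult_zero_left zero_neq_one)
    qed
    show "moment M 0 = 1" using M.prob_space by (simp add: moment_def)
    have "(\<integral>x. complex_of_real x \<partial>M) = 0"
      using lim[OF cpow[of 1]] m1 by (simp add: LIMSEQ_const_iff)
    thus "moment M 1 = 0" using mom[of M 1] by simp
    show "moment M (m + 2) = (\<Sum>p\<le>m. moment \<rho> p * moment M (m - p))" for m
    proof -
      have "(\<lambda>n. \<integral>x. complex_of_real x ^ (m + 2) \<partial>\<mu> (r n)) \<longlonglongrightarrow>
          (\<Sum>p\<le>m. (\<integral>x. complex_of_real x ^ p \<partial>\<rho>) * (\<integral>x. complex_of_real x ^ (m - p) \<partial>M))"
        unfolding rec by (intro tendsto_intros lim[OF cpow] lim\<rho>[OF cpow])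
      from LIMSEQ_unique[OF lim[OF cpow] this]
      have "complex_of_real (moment M (m + 2)) = complex_of_real (\<Sum>p\<le>m. moment \<rho> p * moment M (m - p))"
        unfolding mom by simp
      thus ?thesis by (simp only: of_real_eq_iff)
    qed
  qed
qed

text \<open>With \<open>t = s / S\<close> this turns \<open>g\<close> of the limit theorem into an
  ordinary Cauchy transform.\<close>

lemma cpm_scale:
  fixes t :: real
  assumes "cpm \<nu>"
  defines "\<rho> \<equiv> distr \<nu> borel (\<lambda>x. t * x)"
  shows "cpm \<rho>" and "moment \<rho> p = t ^ p * moment \<nu> p"
    and "Im z \<noteq> 0 \<Longrightarrow> cauchy_transform \<rho> z = (\<integral>x. 1 / (z - complex_of_real (t * x)) \<partial>\<nu>)"
proof -
  from assms(1) obtain K where \<nu>: "real_distribution \<nu>" and K: "AE x in \<nu>. \<bar>x\<bar> \<le> K"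
    by (auto simp: cpm_iff)
  interpret real_distribution \<nu> by fact
  have meas: "(\<lambda>x. t * x) \<in> borel_measurable \<nu>" by measurable
  have "AE x in \<nu>. \<bar>t * x\<bar> \<le> \<bar>t\<bar> * K"
    using K by eventually_elim (auto simp: abs_mult intro: mult_left_mono)
  hence "AE x in \<rho>. \<bar>x\<bar> \<le> \<bar>t\<bar> * K"
    unfolding \<rho>_def using meas by (subst AE_distr_iff) auto
  moreover have "real_distribution \<rho>"
    unfolding \<rho>_def using meas by (rule real_distribution_distr)
  ultimately show "cpm \<rho>" by (auto simp: cpm_iff)
  show "moment \<rho> p = t ^ p * moment \<nu> p"
    unfolding moment_def \<rho>_def using meas by (subst integral_distr) (auto simp: power_mult_distrib)
  show "cauchy_transform \<rho> z = (\<integral>x. 1 / (z - complex_of_real (t * x)) \<partial>\<nu>)" if "Im z \<noteq> 0"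
    unfolding cauchy_transform_def \<rho>_def
    by (rule integral_distr[OF meas borel_measurable_continuous_onI[OF continuous_inverse_linear[OF that]]])
qed

subsection \<open>Words and condition A\<close>

text \<open>These index the terms in the noncommutative expansion of
  \<open>(\<Sum>j<n. X j) ^ m\<close>.\<close>

definition words :: "nat \<Rightarrow> nat \<Rightarrow> nat list set" where
  "words n m = {js. set js \<subseteq> {..<n} \<and> length js = m}"

lemma finite_words [simp]: "finite (words n m)"
  unfolding words_def by (simp add: finite_lists_length_eq)

lemma card_words: "card (words n m) = n ^ m"
  unfolding words_def by (simp add: card_lists_length_eq)

lemma words_0 [simp]: "words n 0 = {[]}"
  unfolding words_def by auto

lemma sum_words_append:
  "(\<Sum>w\<in>words n (p + q). f w) = (\<Sum>u\<in>words n p. \<Sum>v\<in>words n q. f (u @ v))"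
proof -
  have "bij_betw (\<lambda>(u, v). u @ v) (words n p \<times> words n q) (words n (p + q))"
    by (rule bij_betw_byWitness[where f' = "\<lambda>w. (take p w, drop p w)"])
       (auto simp: words_def dest: in_set_takeD in_set_dropD)
  from sum.reindex_bij_betw[OF this, of f] show ?thesis
    by (simp add: sum.cartesian_product case_prod_unfold)
qed

lemma sum_words_1: "(\<Sum>w\<in>words n 1. f w) = (\<Sum>k<n. f [k])"
proof -
  have "words n 1 = (\<lambda>k. [k]) ` {..<n}"
    by (auto simp: words_def length_Suc_conv)
  thus ?thesis by (simp add: sum.reindex inj_on_def)
qed

lemma sum_words_Suc:
  "(\<Sum>w\<in>words n (Suc m). f w) = (\<Sum>k<n. \<Sum>u\<in>words n m. f (k # u))"
  using sum_words_append[of f n 1 m] sum_words_1[of "\<lambda>u. \<Sum>v\<in>words n m. f (u @ v)" n]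
  by simp

text \<open>Such a word is determined by a list \<open>f\<close> of \<open>d\<close> letters and,
  for each of its \<open>m\<close> places, a position in \<open>f\<close>: at most
  \<open>n ^ d\<close> times \<open>d ^ m\<close> choices.\<close>

lemma card_words_few_letters:
  assumes "m > 0"
  shows "card {w \<in> words n m. card (set w) \<le> d} \<le> n ^ d * d ^ m"
proof -
  have "{w \<in> words n m. card (set w) \<le> d} \<subseteq>
      (\<lambda>(f, g). map ((!) f) g) ` (words n d \<times> words d m)"
  proof
    fix w assume w: "w \<in> {w \<in> words n m. card (set w) \<le> d}"
    hence w1: "set w \<subseteq> {..<n}" "length w = m" "card (set w) \<le> d" by (auto simp: words_def)
    hence ne: "w \<noteq> []" using assms by auto
    \<comment> \<open>The distinct letters, padded to length exactly \<open>d\<close> by repeating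
      the first letter; this is where \<open>w\<close> must be nonempty.\<close>
    define f where "f = remdups w @ replicate (d - card (set w)) (hd w)"
    have setf: "set f = set w" using ne by (auto simp: f_def)
    have lenf: "length f = d" using w1 by (simp add: f_def length_remdups_card_conv)
    have ex: "\<forall>x\<in>set w. \<exists>i<d. f ! i = x"
      using setf lenf by (metis in_set_conv_nth)
    define h where "h x = (SOME i. i < d \<and> f ! i = x)" for x
    have h: "h x < d \<and> f ! h x = x" if "x \<in> set w" for x
      unfolding h_def by (rule someI_ex) (use ex that in auto)
    have "w = map ((!) f) (map h w)"
      by (simp add: map_idI h)
    moreover have "f \<in> words n d" using setf lenf w1 by (auto simp: words_def)
    moreover have "map h w \<in> words d m" using h w1 by (auto simp: words_def)
    ultimately show "w \<in> (\<lambda>(f, g). map ((!) f) g) ` (words n d \<times> words d m)"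
      by (metis (no_types, lifting) case_prod_conv image_eqI mem_Sigma_iff)
  qed
  hence "card {w \<in> words n m. card (set w) \<le> d} \<le> card (words n d \<times> words d m)"
    by (intro surj_card_le) auto
  thus ?thesis by (simp add: card_cartesian_product card_words)
qed

lemma wprod_Nil [simp]: "wprod X [] = 1"
  and wprod_Cons: "wprod X (k # js) = X k * wprod X js"
  and wprod_append: "wprod X (us @ vs) = wprod X us * wprod X vs"
  by (simp_all add: wprod_def)

lemma power_sum_words: "(\<Sum>j<n. X j) ^ m = (\<Sum>w\<in>words n m. wprod X w)"
proof (induction m)
  case (Suc m)
  have "(\<Sum>j<n. X j) ^ Suc m = (\<Sum>j<n. X j) * (\<Sum>w\<in>words n m. wprod X w)"
    using Suc by simp
  also have "\<dots> = (\<Sum>j<n. \<Sum>w\<in>words n m. X j * wprod X w)"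
    by (rule sum_product)
  also have "\<dots> = (\<Sum>w\<in>words n (Suc m). wprod X w)"
    unfolding sum_words_Suc by (simp add: wprod_Cons)
  finally show ?case .
qed simp

text \<open>The length is the sum of the multiplicities, all at least 2 and one at least 3.\<close>

lemma card_less_half_length:
  assumes "\<And>x. x \<in> set w \<Longrightarrow> count_list w x \<ge> 2" "k \<in> set w" "count_list w k \<ge> 3"
  shows "2 * card (set w) < length w"
proof -
  have "2 * card (set w) = (\<Sum>x\<in>set w. 2)" by simp
  also have "\<dots> < (\<Sum>x\<in>set w. count_list w x)"
    using assms by (intro sum_strict_mono_ex1) (auto intro!: bexI[of _ k])
  also have "\<dots> = length w"
    by (rule sum_count_set) auto
  finally show ?thesis .
qed

lemma is_state_sum:
  assumes "is_state sc st f"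
  shows "f (\<Sum>i\<in>A. g i) = (\<Sum>i\<in>A. f (g i))"
proof (rule sum_comp_morphism[symmetric, unfolded o_def, of f g A])
  show add: "f (x + y) = f x + f y" for x y using assms by (auto simp: is_state_def)
  show "f 0 = 0" using add[of 0 0] by simp
qed

lemma star_algebra_sc_power:
  assumes "star_algebra sc st"
  shows "sc c a ^ m = sc (c ^ m) (a ^ m)"
proof (induction m)
  case 0
  show ?case using assms by (simp add: star_algebra_def)
next
  case (Suc m)
  have "sc c a ^ Suc m = sc c a * sc (c ^ m) (a ^ m)" using Suc by simp
  also have "\<dots> = sc (c ^ m) (sc c a * a ^ m)" using assms unfolding star_algebra_def by metis
  also have "\<dots> = sc (c ^ m) (sc c (a * a ^ m))" using assms unfolding star_algebra_def by metis
  also have "\<dots> = sc (c ^ m * c) (a * a ^ m)" using assms unfolding star_algebra_def by metis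
  finally show ?case by (simp add: mult.commute)
qed

lemma is_state_sc_power:
  assumes "star_algebra sc st" "is_state sc st f"
  shows "f (sc c a ^ m) = c ^ m * f (a ^ m)"
  using assms(2) unfolding star_algebra_sc_power[OF assms(1)] is_state_def by metis

section \<open>Vanishing and factorisation of word moments under condition A\<close>

context
  fixes \<phi> \<psi> :: "'a::ring_1 \<Rightarrow> complex" and X :: "nat \<Rightarrow> 'a"
  assumes condA: "kargin_condA \<phi> \<psi> X" and tr: "tracial \<psi>"
begin

lemma phi_singleton:
  assumes "count_list w l = 1"
  shows "\<phi> (wprod X w) = 0"
proof -
  obtain u v where w: "w = u @ l # v" "l \<notin> set u" "l \<notin> set v"
    using count_list_Suc_split_first[of w l 0] assms by (auto simp: count_list_0_iff)
  have "l \<notin> set (u @ v)" "length u \<le> length (u @ v)" using w by auto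
  hence "\<phi> (wprod X (take (length u) (u @ v)) * X l * wprod X (drop (length u) (u @ v))) = 0"
    using condA unfolding kargin_condA_def by blast
  thus ?thesis using w by (simp add: wprod_append wprod_Cons mult.assoc)
qed

text \<open>For \<open>\<psi>\<close>, condition (i) covers only an isolated letter in front; the
  trace property rotates the word into this position.\<close>

lemma psi_singleton:
  assumes "count_list w l = 1"
  shows "\<psi> (wprod X w) = 0"
proof -
  obtain u v where w: "w = u @ l # v" "l \<notin> set u" "l \<notin> set v"
    using count_list_Suc_split_first[of w l 0] assms by (auto simp: count_list_0_iff)
  have "l \<notin> set (v @ u)" using w by auto
  hence "\<psi> (X l * wprod X (v @ u)) = 0"
    using condA unfolding kargin_condA_def by blast
  also have "X l * wprod X (v @ u) = wprod X (l # v) * wprod X u"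
    by (simp add: wprod_append wprod_Cons mult.assoc)
  also have "\<psi> \<dots> = \<psi> (wprod X u * wprod X (l # v))"
    using tr unfolding tracial_def by blast
  finally show ?thesis using w by (simp add: wprod_append)
qed

lemma phi_pair:
  assumes "k \<notin> set u" "k \<notin> set v"
  shows "\<phi> (wprod X (k # u @ k # v)) = \<phi> (X k * X k) * \<psi> (wprod X u) * \<phi> (wprod X v)"
proof -
  have "k \<notin> set (u @ v)" "length u \<le> length (u @ v)" using assms by auto
  hence "\<phi> (X k * wprod X (take (length u) (u @ v)) * X k * wprod X (drop (length u) (u @ v))) =
      \<phi> (X k * X k) * \<psi> (wprod X (take (length u) (u @ v))) * \<phi> (wprod X (drop (length u) (u @ v)))"
    using condA unfolding kargin_condA_def by blast
  thus ?thesis by (simp add: wprod_append wprod_Cons mult.assoc)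
qed

section \<open>The factorisation defect\<close>

text \<open>The error in replacing a word moment by factorised terms, one for each recurrence of
  \<open>k\<close> in \<open>u\<close>. All recurrences are counted, not just the first: the parts
  before and after position \<open>p\<close> are then unrestricted, and the sum over all words
  becomes a product of full power moments.\<close>

definition defect :: "nat \<Rightarrow> nat list \<Rightarrow> complex" where
  "defect k u = \<phi> (wprod X (k # u)) - (\<Sum>p<length u. if u ! p = k
     then \<phi> (X k * X k) * \<psi> (wprod X (take p u)) * \<phi> (wprod X (drop (Suc p) u)) else 0)"

text \<open>If the isolated letter is \<open>k\<close>, the sum has no terms. Otherwise it lies in
  exactly one of the two parts around each recurrence of \<open>k\<close> and kills the
  \<open>\<psi>\<close> or the \<open>\<phi>\<close> factor. The moment of the whole word vanishes
  as well.\<close>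

lemma defect_singleton:
  assumes l: "count_list (k # u) l = 1"
  shows "defect k u = 0"
proof -
  have "(if u ! p = k then \<phi> (X k * X k) * \<psi> (wprod X (take p u)) * \<phi> (wprod X (drop (Suc p) u))
      else 0) = 0" if p: "p < length u" for p
  proof (cases "u ! p = k")
    case True
    hence u: "u = take p u @ k # drop (Suc p) u" using id_take_nth_drop[OF p] by simp
    have "l \<noteq> k"
    proof
      assume "l = k"
      hence "count_list u k = 0" using l by simp
      thus False using p True by (metis count_list_0_iff nth_mem)
    qed
    hence "count_list u l = 1" using l by (simp split: if_splits)
    hence "count_list (take p u) l + count_list (drop (Suc p) u) l = 1"
      using u \<open>l \<noteq> k\<close> by (metis count_list_append count_list.simps(2))
    hence "count_list (take p u) l = 1 \<or> count_list (drop (Suc p) u) l = 1" by linarith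
    thus ?thesis using phi_singleton psi_singleton by auto
  qed simp
  moreover have "\<phi> (wprod X (k # u)) = 0" using l by (rule phi_singleton)
  ultimately show ?thesis unfolding defect_def by (simp add: sum.neutral)
qed

text \<open>With a single recurrence of \<open>k\<close> the sum has one term, and condition (ii)
  equates it with the moment.\<close>

lemma defect_pair:
  assumes "count_list (k # u) k = 2"
  shows "defect k u = 0"
proof -
  have "count_list u k = Suc 0" using assms by simp
  then obtain v w where u: "u = v @ k # w" "k \<notin> set v" "k \<notin> set w"
    using count_list_Suc_split_first[of u k 0] by (auto simp: count_list_0_iff)
  have iff: "u ! p = k \<longleftrightarrow> p = length v" if "p < length u" for p
  proof
    assume "u ! p = k"
    show "p = length v"
    proof (rule ccontr)
      assume "p \<noteq> length v"
      then consider "p < length v" | "p > length v" by linarith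
      thus False
      proof cases
        case 1
        hence "u ! p = v ! p" by (simp add: u nth_append)
        thus False using \<open>u ! p = k\<close> u 1 by (metis nth_mem)
      next
        case 2
        hence "u ! p = w ! (p - Suc (length v))" by (simp add: u nth_append)
        moreover have "p - Suc (length v) < length w" using 2 that by (simp add: u)
        ultimately show False using \<open>u ! p = k\<close> u by (metis nth_mem)
      qed
    qed
  qed (simp add: u)
  have "(\<Sum>p<length u. if u ! p = k
     then \<phi> (X k * X k) * \<psi> (wprod X (take p u)) * \<phi> (wprod X (drop (Suc p) u)) else 0) =
     (\<Sum>p<length u. if p = length v
     then \<phi> (X k * X k) * \<psi> (wprod X (take p u)) * \<phi> (wprod X (drop (Suc p) u)) else 0)"
    by (intro sum.cong) (use iff in auto)
  also have "\<dots> = \<phi> (X k * X k) * \<psi> (wprod X v) * \<phi> (wprod X w)"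
    by (simp add: u)
  finally show ?thesis
    unfolding defect_def using phi_pair[OF u(2,3)] u(1) by simp
qed

lemma defect_nonzero:
  assumes "defect k u \<noteq> 0"
  shows "2 * card (set (k # u)) < length (k # u)"
proof (rule card_less_half_length[where k = k])
  have ne: "count_list (k # u) x \<noteq> 1" for x using defect_singleton assms by blast
  show "count_list (k # u) x \<ge> 2" if "x \<in> set (k # u)" for x
  proof -
    have "count_list (k # u) x \<noteq> 0" using that unfolding count_list_0_iff by blast
    thus ?thesis using ne[of x] by linarith
  qed
  show "count_list (k # u) k \<ge> 3"
  proof -
    have "count_list (k # u) k \<noteq> 2" "count_list (k # u) k \<noteq> 0"
      using defect_pair assms by auto
    thus ?thesis using ne[of k] by linarith
  qed
qed simp

lemma norm_defect_le:
  assumes "\<And>j w. length w = j \<Longrightarrow> cmod (\<phi> (wprod X w)) \<le> Cp j"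
    and "\<And>j w. length w = j \<Longrightarrow> cmod (\<psi> (wprod X w)) \<le> Cq j"
    and u: "length u = m"
  shows "cmod (defect k u) \<le> Cp (Suc m) + (\<Sum>p<m. Cp 2 * Cq p * Cp (m - Suc p))"
proof -
  have pos: "Cp j \<ge> 0" "Cq j \<ge> 0" for j
    using assms(1,2)[of "replicate j 0" j] by (auto intro: order_trans[OF norm_ge_zero])
  have 2: "cmod (\<phi> (X k * X k)) \<le> Cp 2"
    using assms(1)[of "[k,k]" 2] by (simp add: wprod_Cons)
  have "cmod (\<Sum>p<length u. if u ! p = k
     then \<phi> (X k * X k) * \<psi> (wprod X (take p u)) * \<phi> (wprod X (drop (Suc p) u)) else 0)
     \<le> (\<Sum>p<length u. Cp 2 * Cq p * Cp (m - Suc p))"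
  proof (rule sum_norm_le)
    fix p assume "p \<in> {..<length u}"
    hence p: "p < m" using u by simp
    have "cmod (\<phi> (X k * X k) * \<psi> (wprod X (take p u)) * \<phi> (wprod X (drop (Suc p) u)))
        \<le> Cp 2 * Cq p * Cp (m - Suc p)"
      unfolding norm_mult using u p pos
      by (intro mult_mono 2 assms mult_nonneg_nonneg) auto
    moreover have "Cp 2 * Cq p * Cp (m - Suc p) \<ge> 0" using pos by simp
    ultimately show "cmod (if u ! p = k
     then \<phi> (X k * X k) * \<psi> (wprod X (take p u)) * \<phi> (wprod X (drop (Suc p) u)) else 0)
      \<le> Cp 2 * Cq p * Cp (m - Suc p)" by auto
  qed
  moreover have "cmod (\<phi> (wprod X (k # u))) \<le> Cp (Suc m)" using assms(1)[of "k # u" "Suc m"] u by simp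
  ultimately show ?thesis
    unfolding defect_def using u by (intro order_trans[OF norm_triangle_ineq4]) auto
qed

text \<open>A nonzero defect forces fewer than half as many distinct letters as places, and such
  words are few.\<close>

lemma norm_sum_defect_le:
  assumes C: "\<And>k u. length u = m \<Longrightarrow> cmod (defect k u) \<le> C"
  shows "cmod (\<Sum>k<n. \<Sum>u\<in>words n m. defect k u) \<le> C * real (n ^ (m div 2) * (m div 2) ^ Suc m)"
proof -
  have C0: "C \<ge> 0" using C[of "replicate m 0" 0] by (auto intro: order_trans[OF norm_ge_zero])
  \<comment> \<open>For length \<open>Suc m\<close>, having fewer than \<open>Suc m / 2\<close>
    distinct letters means having at most \<open>m div 2\<close>.\<close>
  define W where "W = {w \<in> words n (Suc m). card (set w) \<le> m div 2}"
  define D where "D w = defect (hd w) (tl w)" for w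
  have "(\<Sum>k<n. \<Sum>u\<in>words n m. defect k u) = (\<Sum>w\<in>words n (Suc m). D w)"
    by (simp add: sum_words_Suc D_def)
  also have "\<dots> = (\<Sum>w\<in>W. D w)"
  proof (rule sum.mono_neutral_right)
    show "\<forall>w\<in>words n (Suc m) - W. D w = 0"
    proof
      fix w assume w: "w \<in> words n (Suc m) - W"
      then obtain k u where ku: "w = k # u" "length u = m"
        by (auto simp: words_def length_Suc_conv)
      have "\<not> card (set w) \<le> m div 2" using w by (auto simp: W_def)
      hence "\<not> 2 * card (set (k # u)) < length (k # u)" unfolding ku by (simp add: ku(2))
      thus "D w = 0" using defect_nonzero[of k u] ku by (auto simp: D_def)
    qed
  qed (auto simp: W_def)
  also have "cmod \<dots> \<le> of_nat (card W) * C"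
    by (rule sum_norm_bound) (auto simp: W_def words_def D_def C)
  also have "\<dots> \<le> of_nat (n ^ (m div 2) * (m div 2) ^ Suc m) * C"
    unfolding W_def by (intro mult_right_mono of_nat_mono card_words_few_letters C0) auto
  finally show ?thesis by (simp only: mult.commute)
qed

text \<open>Fix the position \<open>p\<close> of the recurrence and split the tail as
  \<open>v @ j # w\<close>, with \<open>v\<close> of length \<open>p\<close> and \<open>w\<close> of
  length \<open>M - p\<close>. The condition \<open>j = k\<close> fixes the middle letter, and the
  sums over \<open>v\<close> and \<open>w\<close> separate into power moments.\<close>

lemma sum_defect:
  assumes states: "is_state sc st \<phi>" "is_state sc st \<psi>"
  shows "(\<Sum>k<n. \<Sum>u\<in>words n (Suc M). defect k u) = \<phi> ((\<Sum>j<n. X j) ^ (M + 2)) -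
     (\<Sum>j<n. \<phi> (X j * X j)) * (\<Sum>p\<le>M. \<psi> ((\<Sum>j<n. X j) ^ p) * \<phi> ((\<Sum>j<n. X j) ^ (M - p)))"
proof -
  define T where "T k p u = (if u ! p = k
     then \<phi> (X k * X k) * \<psi> (wprod X (take p u)) * \<phi> (wprod X (drop (Suc p) u)) else 0)" for k p u
  have T: "(\<Sum>u\<in>words n (Suc M). T k p u) =
      \<phi> (X k * X k) * (\<psi> ((\<Sum>j<n. X j) ^ p) * \<phi> ((\<Sum>j<n. X j) ^ (M - p)))"
    if p: "p \<le> M" and k: "k < n" for k p
  proof -
    have eq: "Suc M = p + Suc (M - p)" using p by simp
    have "(\<Sum>u\<in>words n (Suc M). T k p u) =
      (\<Sum>v\<in>words n p. \<Sum>j<n. \<Sum>w\<in>words n (M - p). T k p (v @ j # w))"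
      unfolding eq sum_words_append sum_words_Suc ..
    also have "\<dots> = (\<Sum>v\<in>words n p. \<Sum>j<n. if j = k then
        (\<Sum>w\<in>words n (M - p). \<phi> (X k * X k) * \<psi> (wprod X v) * \<phi> (wprod X w)) else 0)"
      by (intro sum.cong refl) (auto simp: T_def words_def)
    also have "\<dots> = (\<Sum>v\<in>words n p. \<Sum>w\<in>words n (M - p).
        \<phi> (X k * X k) * \<psi> (wprod X v) * \<phi> (wprod X w))"
      using k by simp
    also have "\<dots> = \<phi> (X k * X k) * ((\<Sum>v\<in>words n p. \<psi> (wprod X v)) *
        (\<Sum>w\<in>words n (M - p). \<phi> (wprod X w)))"
      unfolding sum_product by (simp add: sum_distrib_left mult.assoc)
    finally show ?thesis
      by (simp only: power_sum_words is_state_sum[OF states(1)] is_state_sum[OF states(2)])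
  qed
  have "(\<Sum>k<n. \<Sum>u\<in>words n (Suc M). defect k u) =
      (\<Sum>k<n. \<Sum>u\<in>words n (Suc M). \<phi> (wprod X (k # u)) - (\<Sum>p\<le>M. T k p u))"
    by (intro sum.cong refl)
       (auto simp: defect_def T_def words_def lessThan_Suc_atMost)
  also have "\<dots> = (\<Sum>k<n. \<Sum>u\<in>words n (Suc M). \<phi> (wprod X (k # u))) -
      (\<Sum>k<n. \<Sum>u\<in>words n (Suc M). \<Sum>p\<le>M. T k p u)"
    by (simp add: sum_subtractf)
  also have "(\<Sum>k<n. \<Sum>u\<in>words n (Suc M). \<phi> (wprod X (k # u))) = \<phi> ((\<Sum>j<n. X j) ^ (M + 2))"
    unfolding power_sum_words is_state_sum[OF states(1)] add_2_eq_Suc' sum_words_Suc[of _ _ "Suc M"] ..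
  also have "(\<Sum>k<n. \<Sum>u\<in>words n (Suc M). \<Sum>p\<le>M. T k p u) =
      (\<Sum>k<n. \<Sum>p\<le>M. \<Sum>u\<in>words n (Suc M). T k p u)"
    by (intro sum.cong refl sum.swap)
  also have "\<dots> = (\<Sum>k<n. \<Sum>p\<le>M. \<phi> (X k * X k) *
      (\<psi> ((\<Sum>j<n. X j) ^ p) * \<phi> ((\<Sum>j<n. X j) ^ (M - p))))"
    by (intro sum.cong refl) (auto simp: T)
  also have "\<dots> = (\<Sum>j<n. \<phi> (X j * X j)) *
      (\<Sum>p\<le>M. \<psi> ((\<Sum>j<n. X j) ^ p) * \<phi> ((\<Sum>j<n. X j) ^ (M - p)))"
    by (simp add: sum_product)
  finally show ?thesis .
qed

section \<open>Bounds for \<open>\<psi>\<close> and negligibility of the defect\<close>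

text \<open>Otherwise the averages would have modulus at most \<open>L / 2 + card A * C / n\<close>,
  against their limit \<open>L\<close>. A letter of this kind outside a given word permits division
  by its second moment.\<close>

lemma exists_large_variance:
  assumes bdd: "\<And>k. cmod (\<phi> (X k * X k)) \<le> C" and "0 < L"
    and lim: "(\<lambda>n. (\<Sum>j<n. \<phi> (X j * X j)) / of_nat n) \<longlonglongrightarrow> complex_of_real L"
    and "finite A"
  shows "\<exists>k. k \<notin> A \<and> L / 2 \<le> cmod (\<phi> (X k * X k))"
proof (rule ccontr)
  assume "\<not> ?thesis"
  hence small: "cmod (\<phi> (X k * X k)) \<le> L / 2" if "k \<notin> A" for k
    using that by force
  have C0: "C \<ge> 0" using bdd[of 0] by (auto intro: order_trans[OF norm_ge_zero])
  have le: "cmod ((\<Sum>j<n. \<phi> (X j * X j)) / of_nat n) \<le> L / 2 + card A * C / n" if "n > 0" for n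
  proof -
    have "cmod (\<Sum>j<n. \<phi> (X j * X j)) \<le> (\<Sum>j<n. cmod (\<phi> (X j * X j)))" by (rule norm_sum)
    also have "\<dots> \<le> (\<Sum>j<n. L / 2 + (if j \<in> A then C else 0))"
      using small bdd \<open>0 < L\<close> by (intro sum_mono) (auto intro: order_trans[OF bdd])
    also have "\<dots> = n * (L / 2) + real (card ({..<n} \<inter> A)) * C"
      by (simp add: sum.distrib sum.If_cases)
    also have "\<dots> \<le> n * (L / 2) + card A * C"
      using \<open>finite A\<close> C0 by (intro add_left_mono mult_right_mono of_nat_mono card_mono) auto
    finally show ?thesis using that by (simp add: norm_divide field_simps)
  qed
  have "(\<lambda>n. cmod ((\<Sum>j<n. \<phi> (X j * X j)) / of_nat n)) \<longlonglongrightarrow> L"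
    using tendsto_norm[OF lim] \<open>0 < L\<close> by simp
  moreover have "(\<lambda>n. L / 2 + card A * C / n) \<longlonglongrightarrow> L / 2 + 0"
    by (intro tendsto_add tendsto_const lim_const_over_n)
  ultimately have "L \<le> L / 2 + 0"
    by (rule LIMSEQ_le) (use le in \<open>auto intro!: exI[of _ 1]\<close>)
  thus False using \<open>0 < L\<close> by simp
qed

text \<open>The hypotheses bound only \<open>\<phi>\<close>; condition (ii) with \<open>p = r\<close> gives
  \<open>\<psi>(w) = \<phi>(X\<^sub>k w X\<^sub>k) / \<phi>(X\<^sub>k\<^sup>2)\<close> for \<open>k\<close> not occurring in \<open>w\<close>.\<close>

lemma psi_bounded:
  assumes "\<phi> 1 = 1" and Cp: "\<And>j w. length w = j \<Longrightarrow> cmod (\<phi> (wprod X w)) \<le> Cp j" and "0 < L"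
    and lim: "(\<lambda>n. (\<Sum>j<n. \<phi> (X j * X j)) / of_nat n) \<longlonglongrightarrow> complex_of_real L"
    and "length w = j"
  shows "cmod (\<psi> (wprod X w)) \<le> Cp (j + 2) / (L / 2)"
proof -
  have "cmod (\<phi> (X k * X k)) \<le> Cp 2" for k
    using Cp[of "[k,k]" 2] by (simp add: wprod_Cons)
  from exists_large_variance[OF this \<open>0 < L\<close> lim, of "set w"]
  obtain k where k: "k \<notin> set w" "L / 2 \<le> cmod (\<phi> (X k * X k))" by auto
  have "cmod (\<psi> (wprod X w)) * (L / 2) \<le> cmod (\<psi> (wprod X w)) * cmod (\<phi> (X k * X k))"
    using k by (intro mult_left_mono) auto
  also have "\<dots> = cmod (\<phi> (wprod X (k # w @ [k])))"
    using phi_pair[of k w "[]"] k \<open>\<phi> 1 = 1\<close> by (simp add: norm_mult)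
  also have "\<dots> \<le> Cp (j + 2)" using assms(5) by (intro Cp) auto
  finally show ?thesis using \<open>0 < L\<close> by (simp add: pos_le_divide_eq)
qed

text \<open>The sum is of order \<open>n ^ d\<close> with \<open>2 * d \<le> M + 1\<close>, while
  the normalisation is the power \<open>M + 2\<close> of \<open>sqrt n\<close>; a factor
  \<open>1 / sqrt n\<close> is left over.\<close>

lemma sum_defect_negligible:
  assumes C: "\<And>k u. length u = Suc M \<Longrightarrow> cmod (defect k u) \<le> C"
  shows "(\<lambda>n. (\<Sum>k<n. \<Sum>u\<in>words n (Suc M). defect k u) / of_real (sqrt n) ^ (M + 2)) \<longlonglongrightarrow> 0"
proof -
  define d where "d = Suc M div 2"
  define K where "K = C * real (d ^ Suc (Suc M))"
  have C0: "C \<ge> 0" using C[of "replicate (Suc M) 0" 0] by (auto intro: order_trans[OF norm_ge_zero])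
  have le: "cmod ((\<Sum>k<n. \<Sum>u\<in>words n (Suc M). defect k u) / of_real (sqrt n) ^ (M + 2))
      \<le> K / sqrt n" if n: "n > 0" for n
  proof -
    have "cmod (\<Sum>k<n. \<Sum>u\<in>words n (Suc M). defect k u) \<le> K * real n ^ d"
      using norm_sum_defect_le[of "Suc M" C n, OF C] by (simp add: K_def d_def mult_ac)
    also have "real n ^ d = sqrt n ^ (2 * d)" by (simp add: power_mult)
    also have "K * sqrt n ^ (2 * d) \<le> K * sqrt n ^ Suc M"
      using n C0 by (intro mult_left_mono power_increasing) (auto simp: d_def K_def)
    finally have "cmod (\<Sum>k<n. \<Sum>u\<in>words n (Suc M). defect k u) / sqrt n ^ (M + 2) \<le>
        K * sqrt n ^ Suc M / sqrt n ^ (M + 2)"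
      using n by (intro divide_right_mono) auto
    also have "\<dots> = K / sqrt n" using n by (simp add: field_simps)
    finally show ?thesis
      by (simp only: norm_divide norm_power norm_of_real real_sqrt_abs2 abs_of_nonneg
          real_sqrt_ge_zero of_nat_0_le_iff)
  qed
  show ?thesis
  proof (rule Lim_null_comparison)
    show "\<forall>\<^sub>F n in sequentially. cmod ((\<Sum>k<n. \<Sum>u\<in>words n (Suc M). defect k u) /
        of_real (sqrt n) ^ (M + 2)) \<le> K / sqrt n"
      by (rule eventually_sequentiallyI[of 1], rule le) simp
    show "(\<lambda>n. K / sqrt (real n)) \<longlonglongrightarrow> 0"
      by (intro tendsto_divide_0[OF tendsto_const] filterlim_at_top_imp_at_infinity
          filterlim_compose[OF sqrt_at_top filterlim_real_sequentially])
  qed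
qed

end

subsection \<open>The limit theorem\<close>

text \<open>Division by a positive real stays within the principal branch.\<close>

lemma csqrt_divide_of_nat:
  assumes "n > 0"
  shows "csqrt (z / of_nat n) = csqrt z / complex_of_real (sqrt (real n))"
proof (rule csqrt_unique)
  have "complex_of_real (sqrt (real n)) ^ 2 = of_nat n"
    by (simp flip: of_real_power)
  thus "(csqrt z / complex_of_real (sqrt (real n)))\<^sup>2 = z / of_nat n"
    by (simp add: power_divide)
  show "0 < Re (csqrt z / complex_of_real (sqrt (real n))) \<or>
      Re (csqrt z / complex_of_real (sqrt (real n))) = 0 \<and> 0 \<le> Im (csqrt z / complex_of_real (sqrt (real n)))"
    using csqrt_principal[of z] assms by auto
qed

text \<open>The limit \<open>L\<^sup>2\<close> lies off the branch cut, so \<open>csqrt\<close> is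
  continuous there.\<close>

lemma tendsto_csqrt_over_sqrt:
  assumes lim: "(\<lambda>n. V n / of_nat n) \<longlonglongrightarrow> complex_of_real (L\<^sup>2)" and "0 < L"
  shows "(\<lambda>n. csqrt (V n) / complex_of_real (sqrt (real n))) \<longlonglongrightarrow> complex_of_real L"
proof -
  have "complex_of_real (L\<^sup>2) \<notin> \<real>\<^sub>\<le>\<^sub>0" using \<open>0 < L\<close> by (simp add: complex_nonpos_Reals_iff)
  from isCont_tendsto_compose[OF continuous_at_csqrt[OF this] lim]
  have "(\<lambda>n. csqrt (V n / of_nat n)) \<longlonglongrightarrow> complex_of_real L"
    using \<open>0 < L\<close> by (simp add: csqrt_of_real_nonneg del: of_real_power)
  thus ?thesis
    by (rule Lim_transform_eventually)
       (auto intro!: eventually_sequentiallyI[of 1] simp: csqrt_divide_of_nat)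
qed

theorem theorem4p2:
  fixes sc :: "complex \<Rightarrow> 'a::ring_1 \<Rightarrow> 'a" and st :: "'a \<Rightarrow> 'a"
    and \<phi> \<psi> :: "'a \<Rightarrow> complex" and X :: "nat \<Rightarrow> 'a"
    and s S :: real and \<nu> :: "real measure"
  assumes alg: "star_algebra sc st"
    and st_phi: "is_state sc st \<phi>" and st_psi: "is_state sc st \<psi>" and tr: "tracial \<psi>"
    and condA: "kargin_condA \<phi> \<psi> X"
    and bdd: "\<forall>k\<ge>1. \<exists>C. \<forall>js. length js = k \<longrightarrow> cmod (\<phi> (wprod X js)) \<le> C"
    and lim_s: "(\<lambda>n. (\<Sum>j<n. \<psi> (X j * X j)) / of_nat n) \<longlonglongrightarrow> complex_of_real (s\<^sup>2)"
    and lim_S: "(\<lambda>n. (\<Sum>j<n. \<phi> (X j * X j)) / of_nat n) \<longlonglongrightarrow> complex_of_real (S\<^sup>2)"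
    and pos: "0 < s" "0 < S"
    and nu: "cpm \<nu>"
    and psi_mom: "\<forall>m. (\<lambda>n. \<psi> ((sc (1 / csqrt (\<Sum>j<n. \<psi> (X j * X j))) (\<Sum>j<n. X j)) ^ m))
                        \<longlonglongrightarrow> complex_of_real (moment \<nu> m)"
  shows "\<exists>\<mu>. cpm \<mu> \<and>
           (\<forall>z. Im z \<noteq> 0 \<longrightarrow> cauchy_transform \<mu> z =
               1 / (z - (\<integral>x. complex_of_real S / (complex_of_real S * z - complex_of_real (s * x)) \<partial>\<nu>))) \<and>
           (\<forall>\<mu>'. cpm \<mu>' \<and>
              (\<forall>z. Im z \<noteq> 0 \<longrightarrow> cauchy_transform \<mu>' z =
                 1 / (z - (\<integral>x. complex_of_real S / (complex_of_real S * z - complex_of_real (s * x)) \<partial>\<nu>)))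
              \<longrightarrow> \<mu>' = \<mu>) \<and>
           (\<forall>m. (\<lambda>n. \<phi> ((sc (1 / csqrt (\<Sum>j<n. \<phi> (X j * X j))) (\<Sum>j<n. X j)) ^ m))
                  \<longlonglongrightarrow> complex_of_real (moment \<mu> m))"
proof -
  define \<rho> where "\<rho> = distr \<nu> borel (\<lambda>x. (s / S) * x)"
  have \<rho>: "cpm \<rho>" "moment \<rho> p = (s / S) ^ p * moment \<nu> p" for p
    unfolding \<rho>_def by (rule cpm_scale[OF nu])+
  have g: "(\<integral>x. complex_of_real S / (complex_of_real S * z - complex_of_real (s * x)) \<partial>\<nu>) = cauchy_transform \<rho> z"
    if "Im z \<noteq> 0" for z
  proof -
    have "complex_of_real S / (complex_of_real S * z - complex_of_real (s * x)) =
        1 / (z - complex_of_real (s / S * x))" for x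
    proof -
      have "complex_of_real S * z - complex_of_real (s * x) = complex_of_real S * (z - complex_of_real (s / S * x))"
        using pos by (simp add: algebra_simps)
      thus ?thesis using pos by simp
    qed
    thus ?thesis unfolding \<rho>_def cpm_scale(3)[OF nu that] by (simp only:)
  qed
  obtain \<mu> where \<mu>: "cpm \<mu>"
    and ct: "\<And>z. Im z \<noteq> 0 \<Longrightarrow> cauchy_transform \<mu> z = 1 / (z - cauchy_transform \<rho> z)"
    and mom0: "moment \<mu> 0 = 1" and mom1: "moment \<mu> 1 = 0"
    and mom: "\<And>m. moment \<mu> (m + 2) = (\<Sum>p\<le>m. moment \<rho> p * moment \<mu> (m - p))"
    using cauchy_transform_reciprocal[OF \<rho>(1)] by blast

  define T where "T n = (\<Sum>j<n. X j)" for n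
  \<comment> \<open>Both kinds of moments are normalised by the common factor \<open>sqrt n\<close>,
    in which the recursion is homogeneous. The ratios \<open>vs\<close> and \<open>vS\<close>, with
    limits \<open>s\<close> and \<open>S\<close>, convert from and to the variance
    normalisation.\<close>
  define a where "a m n = \<phi> (T n ^ m) / complex_of_real (sqrt (real n)) ^ m" for m n
  define b where "b m n = \<psi> (T n ^ m) / complex_of_real (sqrt (real n)) ^ m" for m n
  define vs where "vs n = csqrt (\<Sum>j<n. \<psi> (X j * X j)) / complex_of_real (sqrt (real n))" for n
  define vS where "vS n = csqrt (\<Sum>j<n. \<phi> (X j * X j)) / complex_of_real (sqrt (real n))" for n
  have vs: "vs \<longlonglongrightarrow> complex_of_real s" and vS: "vS \<longlonglongrightarrow> complex_of_real S"
    unfolding vs_def vS_def using tendsto_csqrt_over_sqrt[OF lim_s] tendsto_csqrt_over_sqrt[OF lim_S] pos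
    by simp_all
  have lim_b: "b m \<longlonglongrightarrow> complex_of_real (s ^ m * moment \<nu> m)" for m
  proof -
    \<comment> \<open>Cancelling \<open>csqrt\<close> requires a nonzero variance sum, which is
      available only for large \<open>n\<close>.\<close>
    have "\<forall>\<^sub>F n in sequentially. vs n \<noteq> 0"
      using vs pos by (intro tendsto_imp_eventually_ne) auto
    hence "\<forall>\<^sub>F n in sequentially.
        vs n ^ m * \<psi> ((sc (1 / csqrt (\<Sum>j<n. \<psi> (X j * X j))) (T n)) ^ m) = b m n"
    proof eventually_elim
      case (elim n)
      hence "csqrt (\<Sum>j<n. \<psi> (X j * X j)) \<noteq> 0" by (auto simp: vs_def)
      thus ?case
        unfolding is_state_sc_power[OF alg st_psi] by (simp add: vs_def b_def field_simps)
    qed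
    moreover have "(\<lambda>n. vs n ^ m * \<psi> ((sc (1 / csqrt (\<Sum>j<n. \<psi> (X j * X j))) (T n)) ^ m))
        \<longlonglongrightarrow> complex_of_real s ^ m * complex_of_real (moment \<nu> m)"
      unfolding T_def using psi_mom by (intro tendsto_mult tendsto_power vs) blast
    ultimately have "b m \<longlonglongrightarrow> complex_of_real s ^ m * complex_of_real (moment \<nu> m)"
      by (blast intro: Lim_transform_eventually)
    thus ?thesis by simp
  qed

  have one: "\<phi> 1 = 1" using st_phi by (auto simp: is_state_def)
  \<comment> \<open>The boundedness hypothesis starts at length 1; the empty word has moment
    1.\<close>
  have "\<exists>C. \<forall>js. length js = k \<longrightarrow> cmod (\<phi> (wprod X js)) \<le> C" for k
    using bdd one by (cases "k = 0") (auto intro!: exI[of _ 1])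
  then obtain Cp where Cp: "\<And>k js. length js = k \<Longrightarrow> cmod (\<phi> (wprod X js)) \<le> Cp k"
    by metis
  have S2: "0 < S\<^sup>2" using pos by simp
  note Cq = psi_bounded[OF condA tr one Cp S2 lim_S]
  \<comment> \<open>An exact identity at each positive \<open>n\<close>: two of the
    \<open>M + 2\<close> factors \<open>sqrt n\<close> turn the sum of second moments into their
    average, and the other \<open>M\<close> are shared between \<open>b p\<close> and
    \<open>a (M - p)\<close>.\<close>
  have recursion: "a (M + 2) n = ((\<Sum>j<n. \<phi> (X j * X j)) / of_nat n) * (\<Sum>p\<le>M. b p n * a (M - p) n) +
      (\<Sum>k<n. \<Sum>u\<in>words n (Suc M). defect \<phi> \<psi> X k u) / complex_of_real (sqrt n) ^ (M + 2)"
    (is "_ = ?v * _ + ?e") if "n > 0" for M n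
  proof -
    define q where "q = complex_of_real (sqrt (real n))"
    have q: "q \<noteq> 0" "q ^ 2 = of_nat n" using that by (auto simp: q_def simp flip: of_real_power)
    have "(\<Sum>p\<le>M. b p n * a (M - p) n) = (\<Sum>p\<le>M. \<psi> (T n ^ p) * \<phi> (T n ^ (M - p))) / q ^ M"
      unfolding sum_divide_distrib
      by (intro sum.cong refl) (simp add: a_def b_def q_def[symmetric] flip: power_add)
    hence "?v * (\<Sum>p\<le>M. b p n * a (M - p) n) =
        (\<Sum>j<n. \<phi> (X j * X j)) * (\<Sum>p\<le>M. \<psi> (T n ^ p) * \<phi> (T n ^ (M - p))) / q ^ (M + 2)"
      by (simp only: q(2)[symmetric] power_add times_divide_times_eq mult.commute)
    thus ?thesis
      unfolding sum_defect[OF condA tr st_phi st_psi] T_def[symmetric] q_def[symmetric]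
      by (simp add: a_def q_def[symmetric] diff_divide_distrib)
  qed
  \<comment> \<open>Induction along the moment recursion of \<open>\<mu>\<close>: orders 0 and 1 are
    direct, and order \<open>M + 2\<close> uses the limits of all orders up to
    \<open>M\<close>.\<close>
  have lim_a: "a m \<longlonglongrightarrow> complex_of_real (S ^ m * moment \<mu> m)" for m
  proof (induction m rule: less_induct)
    case (less m)
    consider "m = 0" | "m = 1" | M where "m = M + 2"
      by (metis One_nat_def add_2_eq_Suc' not0_implies_Suc)
    thus ?case
    proof cases
      case 1
      thus ?thesis using mom0 one by (simp add: a_def)
    next
      case 2
      have "\<phi> (X j) = 0" for j
        using phi_singleton[OF condA tr, of "[j]" j] by (simp add: wprod_Cons)
      hence "\<phi> (T n) = 0" for n by (simp add: T_def is_state_sum[OF st_phi])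
      thus ?thesis using mom1 2 by (simp add: a_def)
    next
      case 3
      have "(\<lambda>n. (\<Sum>k<n. \<Sum>u\<in>words n (Suc M). defect \<phi> \<psi> X k u) / complex_of_real (sqrt n) ^ (M + 2)) \<longlonglongrightarrow> 0"
        by (rule sum_defect_negligible[OF condA tr norm_defect_le[OF condA tr Cp Cq]]) assumption+
      moreover have "a (M - p) \<longlonglongrightarrow> complex_of_real (S ^ (M - p) * moment \<mu> (M - p))" for p
        using less 3 by simp
      ultimately have "(\<lambda>n. ((\<Sum>j<n. \<phi> (X j * X j)) / of_nat n) * (\<Sum>p\<le>M. b p n * a (M - p) n) +
          (\<Sum>k<n. \<Sum>u\<in>words n (Suc M). defect \<phi> \<psi> X k u) / complex_of_real (sqrt n) ^ (M + 2)) \<longlonglongrightarrow>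
        complex_of_real (S\<^sup>2) * (\<Sum>p\<le>M. complex_of_real (s ^ p * moment \<nu> p) *
          complex_of_real (S ^ (M - p) * moment \<mu> (M - p))) + 0"
        by (intro tendsto_add tendsto_mult tendsto_sum lim_S lim_b)
      hence "a (M + 2) \<longlonglongrightarrow> complex_of_real (S\<^sup>2) * (\<Sum>p\<le>M. complex_of_real (s ^ p * moment \<nu> p) *
          complex_of_real (S ^ (M - p) * moment \<mu> (M - p))) + 0"
        by (rule Lim_transform_eventually)
           (auto intro!: eventually_sequentiallyI[of 1] simp: recursion simp del: power_Suc add_2_eq_Suc')
      \<comment> \<open>The moments of \<open>\<rho>\<close> carry the factor
        \<open>(s / S) ^ p\<close>, so \<open>S ^ M\<close> comes out of every summand and the
        recursion of \<open>\<mu>\<close> remains.\<close>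
      moreover have "S\<^sup>2 * (\<Sum>p\<le>M. (s ^ p * moment \<nu> p) * (S ^ (M - p) * moment \<mu> (M - p))) =
          S ^ (M + 2) * moment \<mu> (M + 2)"
      proof -
        have "(s ^ p * moment \<nu> p) * (S ^ (M - p) * moment \<mu> (M - p)) =
            S ^ M * (moment \<rho> p * moment \<mu> (M - p))" if "p \<le> M" for p
        proof -
          have "S ^ M = S ^ p * S ^ (M - p)" using that by (simp flip: power_add)
          thus ?thesis using pos by (simp add: \<rho> power_divide)
        qed
        hence "(\<Sum>p\<le>M. (s ^ p * moment \<nu> p) * (S ^ (M - p) * moment \<mu> (M - p))) =
            S ^ M * moment \<mu> (M + 2)"
          unfolding mom sum_distrib_left by (intro sum.cong) auto
        thus ?thesis by (simp add: power_add power2_eq_square)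
      qed
      hence "complex_of_real (S\<^sup>2) * (\<Sum>p\<le>M. complex_of_real (s ^ p * moment \<nu> p) *
          complex_of_real (S ^ (M - p) * moment \<mu> (M - p))) = complex_of_real (S ^ (M + 2) * moment \<mu> (M + 2))"
        by (metis (no_types, lifting) of_real_mult of_real_sum sum.cong)
      ultimately show ?thesis unfolding 3 by simp
    qed
  qed

  show ?thesis
  proof (intro exI[of _ \<mu>] conjI allI impI)
    show "cpm \<mu>" by fact
    show "cauchy_transform \<mu> z =
        1 / (z - (\<integral>x. complex_of_real S / (complex_of_real S * z - complex_of_real (s * x)) \<partial>\<nu>))"
      if "Im z \<noteq> 0" for z
      unfolding g[OF that] ct[OF that] ..
    show "\<mu>' = \<mu>" if "cpm \<mu>' \<and> (\<forall>z. Im z \<noteq> 0 \<longrightarrow> cauchy_transform \<mu>' z =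
        1 / (z - (\<integral>x. complex_of_real S / (complex_of_real S * z - complex_of_real (s * x)) \<partial>\<nu>)))" for \<mu>'
    proof (rule moments_determine_cpm)
      show "moment \<mu>' k = moment \<mu> k" for k
        by (rule cauchy_transform_moments_eq) (use that \<mu> ct g in auto)
    qed (use that \<mu> in auto)
    show "(\<lambda>n. \<phi> ((sc (1 / csqrt (\<Sum>j<n. \<phi> (X j * X j))) (\<Sum>j<n. X j)) ^ m))
        \<longlonglongrightarrow> complex_of_real (moment \<mu> m)" for m
    proof -
      have "(\<lambda>n. a m n / vS n ^ m) \<longlonglongrightarrow> complex_of_real (S ^ m * moment \<mu> m) / complex_of_real S ^ m"
        using pos by (intro tendsto_divide lim_a tendsto_power vS) auto
      moreover have "complex_of_real (S ^ m * moment \<mu> m) / complex_of_real S ^ m = complex_of_real (moment \<mu> m)"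
        using pos by simp
      \<comment> \<open>This holds even when the variance sum is zero, since division by zero then
        gives the same value on both sides.\<close>
      moreover have "a m n / vS n ^ m =
          \<phi> ((sc (1 / csqrt (\<Sum>j<n. \<phi> (X j * X j))) (\<Sum>j<n. X j)) ^ m)" if "n > 0" for n
        unfolding is_state_sc_power[OF alg st_phi] using that
        by (simp add: a_def vS_def T_def power_divide)
      hence "\<forall>\<^sub>F n in sequentially. a m n / vS n ^ m =
          \<phi> ((sc (1 / csqrt (\<Sum>j<n. \<phi> (X j * X j))) (\<Sum>j<n. X j)) ^ m)"
        by (intro eventually_sequentiallyI[of 1]) auto
      ultimately show ?thesis by (simp only:) (rule Lim_transform_eventually)
    qed
  qed
qed

end
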